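(* Let $\Phi$ be an epimorphism of a finite thick generalized hexagon $\mathcal{S}$ of order $(s,t)$ onto a thin generalized hexagon $\mathcal{G}$ of order $(s',1)$. Then $s'=1$, and exactly two classes of epimorphisms $\Phi$ occur, up to a suitable permutation of the points of $\mathcal{G}$; that is, after suitably naming the points of $\mathcal{G}$, $\Phi$ is as in (a) or (b) below, and both classes occur. (a) The points of $\mathcal{G}$ are $\overline{a},\overline{b},\overline{c},\overline{d},\overline{e},\overline{f}$, with $\overline{a}\sim\overline{b}\sim\overline{c}\sim\overline{d}\sim\overline{e}\sim\overline{f}\sim\overline{a}$; put $\widetilde{X}=\Phi^{-1}(\overline{x})$ for $\overline{x}\in\{\overline{a},\overline{b},\overline{c},\overline{d},\overline{e},\overline{f}\}$. There is a line $L$ of $\mathcal{S}$ such that $(\widetilde{C},\widetilde{B})$, with $1\le|\widetilde{C}|\le s$ and $1\le|\widetilde{B}|\le s$, is a partition of the set of all points incident with $L$; $\widetilde{D}$ consists of the points not incident with $L$ but collinear with a point of $\widetilde{C}$; $\widetilde{A}$ consists of the points not incident with $L$ but collinear with a point of $\widetilde{B}$; $\widetilde{E}$ consists of the points not in $\widetilde{C}\cup\widetilde{D}$ but collinear with a point of $\widetilde{D}$; and $\widetilde{F}$ consists of the points not in $\widetilde{A}\cup\widetilde{B}$ but collinear with a point of $\widetilde{A}$. Further, $\Phi^{-1}(\overline{b}\overline{c})=\{L\}$; $\Phi^{-1}(\overline{c}\overline{d})$ is the set of all lines distinct from $L$ but incident with a point of $\widetilde{C}$; $\Phi^{-1}(\overline{a}\overline{b})$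 is the set of all lines distinct from $L$ but incident with a point of $\widetilde{B}$; $\Phi^{-1}(\overline{d}\overline{e})$ is the set of all lines distinct from the lines of $\Phi^{-1}(\overline{c}\overline{d})$ but incident with a point of $\widetilde{D}$; $\Phi^{-1}(\overline{f}\overline{a})$ is the set of all lines distinct from the lines of $\Phi^{-1}(\overline{a}\overline{b})$ but incident with a point of $\widetilde{A}$; and $\Phi^{-1}(\overline{f}\overline{e})$ is the set of all lines not in $\Phi^{-1}(\overline{f}\overline{a})$ but incident with a point of $\widetilde{F}$ (that is, the set of all lines not in $\Phi^{-1}(\overline{e}\overline{d})$ but incident with a point of $\widetilde{E}$). (b) The dual of (a), i.e. $\Phi$, regarded as an epimorphism from the point-line dual of $\mathcal{S}$ onto the point-line dual of $\mathcal{G}$, is as in (a).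
   Context: A point-line geometry is a weak generalized $m$-gon ($m\ge 3$) if any two elements (points or lines) lie in a common ordinary sub $m$-gon and there are no ordinary sub $k$-gons for $2\le k<m$; it is thick (a generalized $m$-gon) if every point is on at least three lines and every line has at least three points, and thin if it is not thick. Generalized hexagons are the case $m=6$. Order $(u,v)$ means that each line is incident with $u+1$ points and each point with $v+1$ lines. A thin generalized hexagon of order $(s',1)$, $s'\ge1$, is a thin weak generalized $6$-gon having that order. $x\sim y$ means that the points $x,y$ are collinear, and $\overline{x}\overline{y}$ denotes the line joining distinct collinear points. A morphism maps points to points, lines to lines, and preserves incidence. An epimorphism is a morphism that is surjective on points and surjective on lines (surjectivity on incident point-line pairs is not required). The point-line dual is obtained by interchanging points and lines. *)

theory Defs
  imports Main
begin

record ('p, 'l) geometry =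
  points :: "'p set"
  lines :: "'l set"
  inc :: "'p \<Rightarrow> 'l \<Rightarrow> bool"

definition point_line_geometry :: "('p, 'l) geometry \<Rightarrow> bool" where
  "point_line_geometry G \<longleftrightarrow>
     points G \<noteq> {} \<and> lines G \<noteq> {} \<and>
     (\<forall>x M. inc G x M \<longrightarrow> x \<in> points G \<and> M \<in> lines G)"

definition elements :: "('p, 'l) geometry \<Rightarrow> ('p + 'l) set" where
  "elements G = points G <+> lines G"

definition finite_geometry :: "('p, 'l) geometry \<Rightarrow> bool" where
  "finite_geometry G \<longleftrightarrow> finite (points G) \<and> finite (lines G)"

definition dual :: "('p, 'l) geometry \<Rightarrow> ('l, 'p) geometry" where
  "dual G = \<lparr>points = lines G, lines = points G, inc = (\<lambda>M x. inc G x M)\<rparr>"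

text \<open>Subgeometries carry the induced incidence relation.\<close>

definition subgeometry :: "('p, 'l) geometry \<Rightarrow> ('p, 'l) geometry \<Rightarrow> bool" where
  "subgeometry H G \<longleftrightarrow>
     points H \<subseteq> points G \<and> lines H \<subseteq> lines G \<and>
     (\<forall>x M. inc H x M \<longleftrightarrow> x \<in> points H \<and> M \<in> lines H \<and> inc G x M)"

text \<open>Points \<open>p 0, \<dots>, p (k - 1)\<close> and lines \<open>l 0, \<dots>, l (k - 1)\<close>, where \<open>l j\<close> is the side
  through the consecutive vertices \<open>p j\<close> and \<open>p (j + 1)\<close>, indices modulo \<open>k\<close>;
  meant for \<open>k \<ge> 2\<close>.\<close>

definition ordinary_polygon :: "nat \<Rightarrow> ('p, 'l) geometry \<Rightarrow> bool" where
  "ordinary_polygon k H \<longleftrightarrow>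
     point_line_geometry H \<and>
     (\<exists>p l. bij_betw p {..<k} (points H) \<and> bij_betw l {..<k} (lines H) \<and>
        (\<forall>i<k. \<forall>j<k. inc H (p i) (l j) \<longleftrightarrow> i = j \<or> i = (j + 1) mod k))"

definition weak_generalized_polygon :: "nat \<Rightarrow> ('p, 'l) geometry \<Rightarrow> bool" where
  "weak_generalized_polygon m G \<longleftrightarrow>
     3 \<le> m \<and> point_line_geometry G \<and>
     (\<forall>x\<in>elements G. \<forall>y\<in>elements G.
        \<exists>H. subgeometry H G \<and> ordinary_polygon m H \<and> x \<in> elements H \<and> y \<in> elements H) \<and>
     (\<forall>k. 2 \<le> k \<and> k < m \<longrightarrow> \<not> (\<exists>H. subgeometry H G \<and> ordinary_polygon k H))"

definition thick :: "('p, 'l) geometry \<Rightarrow> bool" where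
  "thick G \<longleftrightarrow>
     (\<forall>x\<in>points G. \<exists>T. T \<subseteq> {M \<in> lines G. inc G x M} \<and> card T = 3) \<and>
     (\<forall>M\<in>lines G. \<exists>T. T \<subseteq> {x \<in> points G. inc G x M} \<and> card T = 3)"

definition has_order :: "('p, 'l) geometry \<Rightarrow> nat \<Rightarrow> nat \<Rightarrow> bool" where
  "has_order G u v \<longleftrightarrow>
     (\<forall>M\<in>lines G. card {x \<in> points G. inc G x M} = u + 1) \<and>
     (\<forall>x\<in>points G. card {M \<in> lines G. inc G x M} = v + 1)"

definition thick_generalized_hexagon :: "('p, 'l) geometry \<Rightarrow> nat \<Rightarrow> nat \<Rightarrow> bool" where
  "thick_generalized_hexagon G s t \<longleftrightarrow>
     weak_generalized_polygon 6 G \<and> thick G \<and> has_order G s t"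

definition thin_generalized_hexagon :: "('p, 'l) geometry \<Rightarrow> nat \<Rightarrow> bool" where
  "thin_generalized_hexagon G s' \<longleftrightarrow>
     1 \<le> s' \<and> weak_generalized_polygon 6 G \<and> \<not> thick G \<and> has_order G s' 1"

definition collinear :: "('p, 'l) geometry \<Rightarrow> 'p \<Rightarrow> 'p \<Rightarrow> bool" where
  "collinear G x y \<longleftrightarrow> (\<exists>M\<in>lines G. inc G x M \<and> inc G y M)"

text \<open>Only meaningful for distinct collinear points of a geometry without digons.\<close>

definition join :: "('p, 'l) geometry \<Rightarrow> 'p \<Rightarrow> 'p \<Rightarrow> 'l" where
  "join G x y = (THE M. M \<in> lines G \<and> inc G x M \<and> inc G y M)"

text \<open>A morphism is a pair: its action on points and its action on lines.
  Only the values on the points and lines of the domain matter.\<close>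

type_synonym ('p, 'l, 'q, 'm) geometry_map = "('p \<Rightarrow> 'q) \<times> ('l \<Rightarrow> 'm)"

definition morphism ::
    "('p, 'l) geometry \<Rightarrow> ('q, 'm) geometry \<Rightarrow> ('p, 'l, 'q, 'm) geometry_map \<Rightarrow> bool" where
  "morphism S G \<Phi> \<longleftrightarrow>
     (\<forall>x\<in>points S. fst \<Phi> x \<in> points G) \<and>
     (\<forall>M\<in>lines S. snd \<Phi> M \<in> lines G) \<and>
     (\<forall>x\<in>points S. \<forall>M\<in>lines S. inc S x M \<longrightarrow> inc G (fst \<Phi> x) (snd \<Phi> M))"

definition epimorphism ::
    "('p, 'l) geometry \<Rightarrow> ('q, 'm) geometry \<Rightarrow> ('p, 'l, 'q, 'm) geometry_map \<Rightarrow> bool" where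
  "epimorphism S G \<Phi> \<longleftrightarrow>
     morphism S G \<Phi> \<and> fst \<Phi> ` points S = points G \<and> snd \<Phi> ` lines S = lines G"

definition dual_map :: "('p, 'l, 'q, 'm) geometry_map \<Rightarrow> ('l, 'p, 'm, 'q) geometry_map" where
  "dual_map \<Phi> = (snd \<Phi>, fst \<Phi>)"

definition point_fibre ::
    "('p, 'l) geometry \<Rightarrow> ('p, 'l, 'q, 'm) geometry_map \<Rightarrow> 'q \<Rightarrow> 'p set" where
  "point_fibre S \<Phi> y = {x \<in> points S. fst \<Phi> x = y}"

definition line_fibre ::
    "('p, 'l) geometry \<Rightarrow> ('p, 'l, 'q, 'm) geometry_map \<Rightarrow> 'm \<Rightarrow> 'l set" where
  "line_fibre S \<Phi> N = {M \<in> lines S. snd \<Phi> M = N}"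

text \<open>The first class of epimorphisms; \<open>s + 1\<close> is the number of points on a line of \<open>S\<close>.
  The existential quantifier over \<open>a, \<dots>, f\<close> is the naming of the points of \<open>G\<close>.\<close>

definition class_a ::
    "('p, 'l) geometry \<Rightarrow> nat \<Rightarrow> ('q, 'm) geometry \<Rightarrow> ('p, 'l, 'q, 'm) geometry_map \<Rightarrow> bool" where
  "class_a S s G \<Phi> \<longleftrightarrow>
     (\<exists>a b c d e f.
        distinct [a, b, c, d, e, f] \<and> points G = {a, b, c, d, e, f} \<and>
        collinear G a b \<and> collinear G b c \<and> collinear G c d \<and>
        collinear G d e \<and> collinear G e f \<and> collinear G f a \<and>
        (let A = point_fibre S \<Phi> a; B = point_fibre S \<Phi> b; C = point_fibre S \<Phi> c;
             D = point_fibre S \<Phi> d; E = point_fibre S \<Phi> e; F = point_fibre S \<Phi> f;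
             AB = line_fibre S \<Phi> (join G a b); BC = line_fibre S \<Phi> (join G b c);
             CD = line_fibre S \<Phi> (join G c d); DE = line_fibre S \<Phi> (join G d e);
             FE = line_fibre S \<Phi> (join G f e); FA = line_fibre S \<Phi> (join G f a)
         in \<exists>L\<in>lines S.
              C \<union> B = {x \<in> points S. inc S x L} \<and> C \<inter> B = {} \<and>
              1 \<le> card C \<and> card C \<le> s \<and> 1 \<le> card B \<and> card B \<le> s \<and>
              D = {x \<in> points S. \<not> inc S x L \<and> (\<exists>y\<in>C. collinear S x y)} \<and>
              A = {x \<in> points S. \<not> inc S x L \<and> (\<exists>y\<in>B. collinear S x y)} \<and>
              E = {x \<in> points S. x \<notin> C \<union> D \<and> (\<exists>y\<in>D. collinear S x y)} \<and>
              F = {x \<in> points S. x \<notin> A \<union> B \<and> (\<exists>y\<in>A. collinear S x y)} \<and>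
              BC = {L} \<and>
              CD = {M \<in> lines S. M \<noteq> L \<and> (\<exists>x\<in>C. inc S x M)} \<and>
              AB = {M \<in> lines S. M \<noteq> L \<and> (\<exists>x\<in>B. inc S x M)} \<and>
              DE = {M \<in> lines S. M \<notin> CD \<and> (\<exists>x\<in>D. inc S x M)} \<and>
              FA = {M \<in> lines S. M \<notin> AB \<and> (\<exists>x\<in>A. inc S x M)} \<and>
              FE = {M \<in> lines S. M \<notin> FA \<and> (\<exists>x\<in>F. inc S x M)} \<and>
              FE = {M \<in> lines S. M \<notin> DE \<and> (\<exists>x\<in>E. inc S x M)}))"

text \<open>If \<open>S\<close> has order \<open>(s, t)\<close> then its dual has order \<open>(t, s)\<close>, so here \<open>t\<close> takes
  over the role of \<open>s\<close>.\<close>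

definition class_b ::
    "('p, 'l) geometry \<Rightarrow> nat \<Rightarrow> ('q, 'm) geometry \<Rightarrow> ('p, 'l, 'q, 'm) geometry_map \<Rightarrow> bool" where
  "class_b S t G \<Phi> \<longleftrightarrow> class_a (dual S) t (dual G) (dual_map \<Phi>)"

end

theory Submission imports Defs begin

text \<open>Let \<open>\<Phi>\<close> be viewed as a graph homomorphism between incidence graphs. If \<open>x\<close> and \<open>y\<close> lie over the ends
  of a path \<open>g\<^sub>0, \<dots>, g\<^sub>6\<close> without backtracking, then projecting from one to the other shows that \<open>x\<close> has
  as many neighbours over \<open>g\<^sub>1\<close> as \<open>y\<close> has over \<open>g\<^sub>5\<close>. Hence, for a 12-cycle \<open>v\<close> in the image, every
  element over \<open>v i\<close> has the same number \<open>p i \<ge> 1\<close> of neighbours over \<open>v (i + 1)\<close>, and \<open>p (i + 6)\<close>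
  neighbours over \<open>v (i - 1)\<close>.

  A walk of length 6 without backtracking whose image goes from \<open>v i\<close> to \<open>v (i + 4)\<close> with one
  detour joins two opposite elements. Comparing their neighbours gives \<open>p (i + 6) < p (i + 10)\<close>, and
  \<open>p (i - 1) = 1\<close> makes such walks impossible. If the image had lines with three points, all \<open>p (2 i)\<close>
  would be 1, contradicting thickness. Otherwise some \<open>p i\<close> is 1, since the strict inequality
  cannot be iterated around the cycle, and the absence of detours propagates this to
  five consecutive values \<open>p i = 1\<close>. Then one fibre is a single element, and all other
  fibres are determined by their distance from it.

  Conversely every thick hexagon is folded onto the 12-cycle by the distance from a line. A finite
  thick hexagon exists by counting walks in the Tutte 12-cage.\<close>

section \<open>Non-backtracking walks\<close>

text \<open>Projections rest on a rigidity of walks. In a hexagon, two elements of different type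
  are joined by a walk of exactly five edges, if backtracking is allowed. When its image has the
  ends of a path of five edges without backtracking, girth 12 of \<open>G\<close> leaves only that
  path. So such a path lifts between any preimages of its ends; for pairs of consecutive elements of
  the cycle, surjectivity follows instead of being assumed. The obstacle is the opposite direction:
  a walk of \<open>S\<close> without backtracking may have an image that folds back. Over an edge
  from \<open>v j\<close> to \<open>v (j + 1)\<close> a zigzag needs \<open>p j\<close> and
  \<open>p (j + 7)\<close> both at least 2, so excluding detours makes one of them 1. As degrees are
  at least 3, \<open>p i\<close> and \<open>p (i + 6)\<close> are never both 1, and this aligns the
  values 1 into one block. Five consecutive values are wanted because lifts have five edges: they
  make each descent of five steps unique, while lifts from one element reach the whole fibre at the
  bottom. Whether that bottom is a line or a point separates (a) from (b).\<close>

fun nb :: "'v list \<Rightarrow> bool" where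
  "nb [] = True"
| "nb [x] = True"
| "nb [x, y] = True"
| "nb (x # y # z # zs) = (x \<noteq> z \<and> nb (y # z # zs))"

definition nbw :: "('v \<Rightarrow> 'v \<Rightarrow> bool) \<Rightarrow> 'v list \<Rightarrow> bool" where
  "nbw E xs \<longleftrightarrow> successively E xs \<and> nb xs"

lemma nb_Cons: "nb (x # y # zs) \<longleftrightarrow> (zs \<noteq> [] \<longrightarrow> x \<noteq> hd zs) \<and> nb (y # zs)"
  by (cases zs) auto

lemma nb_glue:
  "nb (x # xs) \<Longrightarrow> nb (x # ys) \<Longrightarrow> (xs \<noteq> [] \<Longrightarrow> ys \<noteq> [] \<Longrightarrow> hd xs \<noteq> hd ys)
    \<Longrightarrow> nb (rev xs @ x # ys)"
proof (induction xs arbitrary: x ys)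
  case (Cons a xs)
  have "nb (rev xs @ a # x # ys)"
    using Cons.prems by (intro Cons.IH) (cases xs; force simp: nb_Cons)+
  then show ?case by simp
qed auto

lemma nb_map: "nb (map f xs) \<Longrightarrow> nb xs"
  by (induction xs rule: nb.induct) auto

lemma nbw_Cons: "nbw E (x # y # zs) \<longleftrightarrow> E x y \<and> (zs \<noteq> [] \<longrightarrow> x \<noteq> hd zs) \<and> nbw E (y # zs)"
  by (auto simp: nbw_def nb_Cons)

lemma nbw_single [simp]: "nbw E [x]" "nbw E []"
  by (auto simp: nbw_def)

lemma nbw_ConsD: "nbw E (x # xs) \<Longrightarrow> nbw E xs"
  by (cases xs) (auto simp: nbw_Cons)

lemma nbw_snoc:
  "nbw E (xs @ [x]) \<Longrightarrow> E x y \<Longrightarrow> (xs \<noteq> [] \<Longrightarrow> last xs \<noteq> y) \<Longrightarrow> nbw E (xs @ [x, y])"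
proof (induction xs)
  case (Cons a xs)
  then show ?case by (cases xs) (auto simp: nbw_Cons hd_append)
qed (simp add: nbw_Cons)

lemma nbw_butlast: "nbw E (xs @ ys) \<Longrightarrow> nbw E xs"
proof (induction xs)
  case (Cons a xs)
  then show ?case by (cases xs) (auto simp: nbw_Cons hd_append split: if_splits)
qed simp

text \<open>Reduce the tail first, then cancel one backtrack at the front if there is one. That the
  result is either unchanged or strictly shorter lets a length comparison show that nothing was
  cancelled.\<close>

lemma walk_reduce:
  assumes "successively E xs" "xs \<noteq> []"
  shows "\<exists>ys. nbw E ys \<and> ys \<noteq> [] \<and> hd ys = hd xs \<and> last ys = last xs \<and>
           (ys = xs \<or> length ys < length xs)"
  using assms
proof (induction xs)
  case (Cons x xs)
  show ?case
  proof (cases xs)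
    case Nil
    then show ?thesis by (intro exI[of _ "[x]"]) auto
  next
    case (Cons a xs')
    have e: "E x a" using Cons.prems Cons by auto
    obtain ys where ys: "nbw E ys" "ys \<noteq> []" "hd ys = hd xs" "last ys = last xs"
        "ys = xs \<or> length ys < length xs"
      using Cons.IH Cons.prems Cons by auto
    then obtain zs where zs: "ys = a # zs" using Cons by (cases ys) auto
    show ?thesis
    proof (cases "zs \<noteq> [] \<and> hd zs = x")
      case True
      then obtain ws where "zs = x # ws" by (cases zs) auto
      then show ?thesis using ys zs Cons
        by (intro exI[of _ zs]) (auto simp: nbw_Cons dest: nbw_ConsD)
    next
      case False
      then have "nbw E (x # ys)" using ys zs e by (auto simp: nbw_Cons)
      then show ?thesis using ys zs Cons by (intro exI[of _ "x # ys"]) auto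
    qed
  qed
qed simp

section \<open>Graphs of girth at least 12\<close>

locale sym_graph =
  fixes E :: "'v \<Rightarrow> 'v \<Rightarrow> bool"
  assumes sym: "E x y \<Longrightarrow> E y x"
begin

lemma successively_rev_iff: "successively E (rev xs) \<longleftrightarrow> successively E xs"
  using sym by simp (metis (mono_tags, lifting) successively_mono)

lemma nbw_glue:
  assumes "nbw E (x # xs)" "nbw E (x # ys)" "xs \<noteq> [] \<Longrightarrow> ys \<noteq> [] \<Longrightarrow> hd xs \<noteq> hd ys"
  shows "nbw E (rev xs @ x # ys)"
proof -
  have "successively E (rev (x # xs))"
    using assms(1) by (simp only: successively_rev_iff) (simp add: nbw_def)
  then have "successively E (rev xs @ x # ys)"
    using assms(2) by (auto simp: nbw_def successively_append_iff)
  then show ?thesis using nb_glue[of x xs ys] assms by (auto simp: nbw_def)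
qed

lemma nbw_rev: "nbw E xs \<Longrightarrow> nbw E (rev xs)"
  using nbw_glue[of "hd xs" "tl xs" "[]"] by (cases xs) auto

end

text \<open>A cycle with \<open>n\<close> edges is a closed list of \<open>n + 1\<close> vertices,
  so the bound 12 on vertices excludes cycles with at most 11 edges.\<close>

locale girth12 = sym_graph E for E :: "'v \<Rightarrow> 'v \<Rightarrow> bool" +
  assumes girth: "nbw E xs \<Longrightarrow> length xs \<le> 12 \<Longrightarrow> distinct xs"
begin

text \<open>After the common initial part is stripped, the reverse of one walk followed by the other
  does not backtrack where they part. It has at most 12 vertices and equal ends, against the
  girth.\<close>

lemma nbw_unique:
  "nbw E (x # xs) \<Longrightarrow> nbw E (x # ys) \<Longrightarrow> last (x # xs) = last (x # ys) \<Longrightarrow>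
    length xs + length ys \<le> 11 \<Longrightarrow> xs = ys"
proof (induction xs arbitrary: x ys)
  case Nil
  then show ?case using girth[of "x # ys"] by (cases ys rule: rev_cases) auto
next
  case (Cons a xs)
  show ?case
  proof (cases ys)
    case Nil
    then show ?thesis using girth[of "x # a # xs"] Cons.prems
      by (cases xs rule: rev_cases) auto
  next
    case (Cons b ys')
    show ?thesis
    proof (cases "a = b")
      case True
      then have "xs = ys'"
        using Cons.prems Cons by (intro Cons.IH[of a]) (auto dest: nbw_ConsD)
      then show ?thesis using Cons True by simp
    next
      case False
      have "nbw E (rev (a # xs) @ x # ys)"
        using Cons.prems Cons False by (intro nbw_glue) auto
      then have d: "distinct (rev (a # xs) @ x # ys)"
        using Cons.prems by (intro girth) auto
      have "last (a # xs) = last ys" using Cons.prems(3) Cons by simp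
      moreover have "last (a # xs) \<in> set (rev (a # xs))" "last ys \<in> set ys"
        using Cons by (metis last_in_set list.distinct(1) set_rev)+
      ultimately show ?thesis using d by auto
    qed
  qed
qed

lemma nbw_unique':
  "nbw E xs \<Longrightarrow> nbw E ys \<Longrightarrow> hd xs = hd ys \<Longrightarrow> last xs = last ys \<Longrightarrow> xs \<noteq> [] \<Longrightarrow> ys \<noteq> [] \<Longrightarrow>
    length xs + length ys \<le> 13 \<Longrightarrow> xs = ys"
  using nbw_unique[of "hd xs" "tl xs" "tl ys"] by (cases xs; cases ys) auto

text \<open>The reduced form of \<open>xs\<close> and \<open>gs\<close> have together at most 12
  vertices, so they coincide. The reduced form then has the full length, hence \<open>xs\<close> was
  already reduced.\<close>

lemma walk_unique:
  assumes "nbw E gs" "successively E xs" "hd xs = hd gs" "last xs = last gs"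
    "xs \<noteq> []" "length xs = length gs" "length gs \<le> 6"
  shows "xs = gs"
proof -
  obtain ys where ys: "nbw E ys" "ys \<noteq> []" "hd ys = hd xs" "last ys = last xs"
      "ys = xs \<or> length ys < length xs"
    using walk_reduce assms by metis
  have "ys = gs" using ys assms by (intro nbw_unique') auto
  then show ?thesis using ys assms by auto
qed

end

section \<open>Cycles in incidence graphs\<close>

text \<open>Periodicity on all of \<open>nat\<close> avoids reducing indices and makes a rotation a
  mere shift of the argument.\<close>

definition cycle :: "('v \<Rightarrow> 'v \<Rightarrow> bool) \<Rightarrow> nat \<Rightarrow> (nat \<Rightarrow> 'v) \<Rightarrow> bool" where
  "cycle E n c \<longleftrightarrow> inj_on c {..<n} \<and> (\<forall>i. E (c i) (c (Suc i))) \<and> (\<forall>i. c (i + n) = c i)"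

lemma cycle_mod:
  assumes "cycle E n c" shows "c (i mod n) = c i"
proof -
  have "c (j + n * k) = c j" for j k
  proof (induction k)
    case (Suc k)
    have "c (j + n * Suc k) = c ((j + n * k) + n)" by (simp add: algebra_simps)
    then show ?case using assms Suc by (simp add: cycle_def)
  qed simp
  from this[of "i mod n" "i div n"] show ?thesis by simp
qed

lemma cycle_eq_iff:
  assumes "cycle E n c" "0 < n" shows "c i = c j \<longleftrightarrow> i mod n = j mod n"
proof -
  have "c i = c j \<longleftrightarrow> c (i mod n) = c (j mod n)" using cycle_mod[OF assms(1)] by simp
  also have "\<dots> \<longleftrightarrow> i mod n = j mod n"
    using assms by (intro inj_on_eq_iff[of c "{..<n}"]) (auto simp: cycle_def)
  finally show ?thesis .
qed

lemma cycle_image: "cycle E n c \<Longrightarrow> 0 < n \<Longrightarrow> range c = c ` {..<n}"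
  by (auto simp: image_iff) (metis cycle_mod lessThan_iff mod_less_divisor)

lemma cycle_shift:
  assumes "cycle E n c" "0 < n" shows "cycle E n (\<lambda>i. c (i + k))"
proof -
  have "inj_on (\<lambda>i. c (i + k)) {..<n}"
  proof (rule inj_onI)
    fix i j assume ij: "i \<in> {..<n}" "j \<in> {..<n}" "c (i + k) = c (j + k)"
    then have "(i + k) mod n = (j + k) mod n" using cycle_eq_iff[OF assms] by blast
    then have "n dvd (j + k) - (i + k)" if "i \<le> j" 
      using that mod_eq_dvd_iff_nat[of "i + k" "j + k" n] by simp
    moreover have "n dvd (i + k) - (j + k)" if "j \<le> i"
      using that mod_eq_dvd_iff_nat[of "j + k" "i + k" n] \<open>(i + k) mod n = _\<close> by simp
    ultimately show "i = j" using ij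
      by (metis add_diff_cancel_right dvd_imp_le lessThan_iff less_imp_diff_less linorder_le_cases
          linorder_not_le diff_is_0_eq' dual_order.antisym zero_less_diff)
  qed
  moreover have "c (i + n + k) = c (i + k)" for i
    using assms by (metis cycle_def add.assoc add.commute)
  ultimately show ?thesis using assms by (auto simp: cycle_def)
qed

lemma cycleI:
  assumes "0 < n" "inj_on c {..<n}" "\<And>i. Suc i < n \<Longrightarrow> E (c i) (c (Suc i))" "E (c (n - 1)) (c 0)"
  shows "cycle E n (\<lambda>i. c (i mod n))"
  unfolding cycle_def
proof (intro conjI allI)
  show "inj_on (\<lambda>i. c (i mod n)) {..<n}"
    using assms(2) by (auto simp: inj_on_def)
  fix i
  show "E (c (i mod n)) (c (Suc i mod n))"
  proof (cases "Suc (i mod n) < n")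
    case True then show ?thesis using assms(3) by (simp add: mod_Suc)
  next
    case False
    then have "i mod n = n - 1" using assms(1) mod_less_divisor[of n i] by linarith
    then show ?thesis using assms(1,4) by (simp add: mod_Suc)
  qed
qed simp

lemma nbw_nth:
  assumes "nbw E xs"
  shows "Suc i < length xs \<Longrightarrow> E (xs ! i) (xs ! Suc i)"
    and "Suc (Suc i) < length xs \<Longrightarrow> xs ! i \<noteq> xs ! Suc (Suc i)"
  using assms
proof (induction xs arbitrary: i)
  case (Cons x xs)
  {
    case 1
    then show ?case using Cons.IH(1)[of "i - 1"]
      by (cases xs; cases i) (auto simp: nbw_Cons)
  next
    case 2
    then obtain y z zs where "xs = y # z # zs" by (cases xs; cases "tl xs") auto
    then show ?case using 2 Cons.IH(2)[of "i - 1"]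
      by (cases i) (auto simp: nbw_Cons)
  }
qed auto

text \<open>Two equal vertices at the least possible distance \<open>n\<close> bound a cycle;
  absence of loops and of backtracking excludes \<open>n = 1\<close> and
  \<open>n = 2\<close>.\<close>

lemma nbw_cycle:
  assumes "nbw E xs" "\<not> distinct xs" "\<And>x. \<not> E x x"
  shows "\<exists>n c. cycle E n c \<and> 3 \<le> n \<and> n < length xs"
proof -
  define P where "P n \<longleftrightarrow> 0 < n \<and> (\<exists>i. i + n < length xs \<and> xs ! i = xs ! (i + n))" for n
  have "\<exists>n. P n"
  proof -
    obtain i j where "i < j" "j < length xs" "xs ! i = xs ! j"
      using assms(2) by (metis distinct_conv_nth linorder_neqE_nat)
    then have "P (j - i)" by (auto simp: P_def intro!: exI[of _ i])
    then show ?thesis by blast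
  qed
  then obtain n where n: "P n" "\<And>m. m < n \<Longrightarrow> \<not> P m"
    using exists_least_iff[of P] by blast
  then obtain i where i: "0 < n" "i + n < length xs" "xs ! i = xs ! (i + n)"
    by (auto simp: P_def)
  have "n \<noteq> 1" using nbw_nth(1)[OF assms(1), of i] i assms(3) by auto
  moreover have "n \<noteq> 2" using nbw_nth(2)[OF assms(1), of i] i by auto
  ultimately have n3: "3 \<le> n" using i by linarith
  have inj: False if "k < k'" "k' < n" "xs ! (i + k) = xs ! (i + k')" for k k'
  proof -
    have "P (k' - k)" using that i by (auto simp: P_def intro!: exI[of _ "i + k"])
    then show False using n(2)[of "k' - k"] that by auto
  qed
  have "cycle E n (\<lambda>k. xs ! (i + k mod n))"
  proof (rule cycleI)
    show "inj_on (\<lambda>k. xs ! (i + k)) {..<n}"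
      by (rule inj_onI) (metis inj lessThan_iff linorder_neqE_nat)
    show "E (xs ! (i + (n - 1))) (xs ! (i + 0))"
      using nbw_nth(1)[OF assms(1), of "i + (n - 1)"] i by auto
  qed (use i nbw_nth(1)[OF assms(1)] in auto)
  then show ?thesis using n3 i by (intro exI) auto
qed

section \<open>Incidence graphs: cycles and ordinary polygons\<close>

fun adj :: "('p, 'l) geometry \<Rightarrow> 'p + 'l \<Rightarrow> 'p + 'l \<Rightarrow> bool" where
  "adj G (Inl x) (Inr M) = inc G x M"
| "adj G (Inr M) (Inl x) = inc G x M"
| "adj G (Inl x) (Inl y) = False"
| "adj G (Inr M) (Inr N) = False"

lemma adj_sym: "adj G x y \<Longrightarrow> adj G y x"
  by (cases x; cases y) auto

lemma adj_irrefl: "\<not> adj G x x"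
  by (cases x) auto

lemma adj_isl: "adj G x y \<Longrightarrow> isl x \<longleftrightarrow> \<not> isl y"
  by (cases x; cases y) auto

lemma adj_elements:
  "point_line_geometry G \<Longrightarrow> adj G x y \<Longrightarrow> x \<in> elements G \<and> y \<in> elements G"
  by (cases x; cases y) (auto simp: point_line_geometry_def elements_def)

lemma cycle_isl: "cycle (adj G) n c \<Longrightarrow> isl (c i) \<longleftrightarrow> (isl (c 0) \<longleftrightarrow> even i)"
proof (induction i)
  case (Suc i)
  then show ?case using adj_isl[of G "c i" "c (Suc i)"] by (auto simp: cycle_def)
qed simp

lemma cycle_even: "cycle (adj G) n c \<Longrightarrow> even n"
  using cycle_isl[of G n c n] by (simp add: cycle_def) (metis add_0)

lemma polygon_cycle:
  assumes "subgeometry H G" "ordinary_polygon k H" "2 \<le> k"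
  shows "\<exists>c. cycle (adj G) (2 * k) c \<and> elements H = range c"
proof -
  obtain p l where pl: "bij_betw p {..<k} (points H)" "bij_betw l {..<k} (lines H)"
      "\<And>i j. i < k \<Longrightarrow> j < k \<Longrightarrow> inc H (p i) (l j) \<longleftrightarrow> i = j \<or> i = (j + 1) mod k"
    using assms(2) by (auto simp: ordinary_polygon_def)
  have G: "inc G (p i) (l j)" if "i < k" "j < k" "i = j \<or> i = (j + 1) mod k" for i j
    using pl(3)[of i j] that assms(1) by (auto simp: subgeometry_def)
  define c where "c i = (if even i then Inl (p (i div 2)) else Inr (l (i div 2)))" for i
  have cyc: "cycle (adj G) (2 * k) (\<lambda>i. c (i mod (2 * k)))"
  proof (rule cycleI)
    show "inj_on c {..<2 * k}"
    proof (rule inj_onI)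
      fix i j assume ij: "i \<in> {..<2 * k}" "j \<in> {..<2 * k}" "c i = c j"
      then have "even i \<longleftrightarrow> even j" by (auto simp: c_def split: if_splits)
      moreover have "i div 2 = j div 2"
        using ij inj_onD[OF bij_betw_imp_inj_on[OF pl(1)], of "i div 2" "j div 2"]
          inj_onD[OF bij_betw_imp_inj_on[OF pl(2)], of "i div 2" "j div 2"]
        by (auto simp: c_def split: if_splits)
      ultimately show "i = j" by (metis dvd_mult_div_cancel odd_two_times_div_two_succ)
    qed
    show "adj G (c i) (c (Suc i))" if "Suc i < 2 * k" for i
      using that by (auto simp: c_def elim!: oddE evenE intro!: G)
    show "adj G (c (2 * k - 1)) (c 0)"
    proof -
      have "(2 * k - 1) div 2 = k - 1" "odd (2 * k - 1)" using assms(3) by auto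
      then show ?thesis using assms(3) by (auto simp: c_def intro!: G)
    qed
  qed (use assms in auto)
  moreover have "elements H = range (\<lambda>i. c (i mod (2 * k)))"
  proof -
    have "c ` {..<2 * k} = elements H"
    proof (intro equalityI subsetI)
      fix z assume "z \<in> c ` {..<2 * k}"
      then obtain i where "i < 2 * k" "z = c i" by auto
      then show "z \<in> elements H" using pl(1,2)
        by (auto simp: c_def elements_def bij_betw_def)
    next
      fix z assume "z \<in> elements H"
      then consider x where "z = Inl x" "x \<in> points H" | M where "z = Inr M" "M \<in> lines H"
        by (auto simp: elements_def)
      then show "z \<in> c ` {..<2 * k}"
      proof cases
        case 1
        then obtain i where "i < k" "x = p i" using pl(1) by (auto simp: bij_betw_def)
        then show ?thesis using 1 by (intro image_eqI[of _ _ "2 * i"]) (auto simp: c_def)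
      next
        case 2
        then obtain i where "i < k" "M = l i" using pl(2) by (auto simp: bij_betw_def)
        then show ?thesis using 2 by (intro image_eqI[of _ _ "2 * i + 1"]) (auto simp: c_def)
      qed
    qed
    moreover have "range (\<lambda>i. c (i mod (2 * k))) = (\<lambda>i. c (i mod (2 * k))) ` {..<2 * k}"
      using cycle_image[OF cyc] assms(3) by simp
    ultimately show ?thesis by auto
  qed
  ultimately show ?thesis by blast
qed

text \<open>A subgeometry carries all induced incidences, so a chord would spoil the polygon; this
  is why cycles have to be chordless here. Starting in a point puts the points at the even
  positions.\<close>

lemma cycle_polygon_aux:
  assumes plg: "point_line_geometry G" and c: "cycle (adj G) (2 * k) c" "2 \<le> k" "isl (c 0)"
    and chordless: "\<And>i j. i < 2 * k \<Longrightarrow> j < 2 * k \<Longrightarrow> adj G (c i) (c j) \<Longrightarrow>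
      j = Suc i mod (2 * k) \<or> i = Suc j mod (2 * k)"
  shows "\<exists>H. subgeometry H G \<and> ordinary_polygon k H \<and> elements H = range c"
proof -
  define P L where "P = {x. Inl x \<in> range c}" and "L = {M. Inr M \<in> range c}"
  define H where "H = \<lparr>points = P, lines = L, inc = (\<lambda>x M. x \<in> P \<and> M \<in> L \<and> inc G x M)\<rparr>"
  define p l where "p i = projl (c (2 * i))" and "l i = projr (c (2 * i + 1))" for i
  have p: "c (2 * i) = Inl (p i)" for i
  proof -
    have "isl (c (2 * i))" unfolding cycle_isl[OF c(1), of "2 * i"] using c(3) by simp
    then show ?thesis unfolding p_def by (rule sum.collapse(1)[symmetric])
  qed
  have l: "c (2 * i + 1) = Inr (l i)" for i
  proof -
    have "\<not> isl (c (2 * i + 1))" unfolding cycle_isl[OF c(1), of "2 * i + 1"] using c(3) by simp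
    then show ?thesis unfolding l_def by (rule sum.collapse(2)[symmetric])
  qed
  have "c i \<in> points G <+> lines G" for i
    using adj_elements[OF plg, of "c i" "c (Suc i)"] c(1) unfolding cycle_def elements_def by blast
  then have "Inl x = c i \<Longrightarrow> x \<in> points G" "Inr M = c i \<Longrightarrow> M \<in> lines G" for x M i
    by (metis PlusE sum.distinct(1) sum.inject(1), metis PlusE sum.distinct(1) sum.inject(2))
  then have PG: "P \<subseteq> points G" "L \<subseteq> lines G"
    unfolding P_def L_def by blast+
  have im: "range c = c ` {..<2 * k}" using cycle_image[OF c(1)] c(2) by simp
  have eq: "c i = c j \<longleftrightarrow> i = j" if "i < 2 * k" "j < 2 * k" for i j
    using cycle_eq_iff[OF c(1), of i j] c(2) that by simp
  have bp: "bij_betw p {..<k} P"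
    unfolding bij_betw_def
  proof
    show "inj_on p {..<k}"
    proof (rule inj_onI)
      fix i j assume "i \<in> {..<k}" "j \<in> {..<k}" "p i = p j"
      then show "i = j" using p[of i] p[of j] eq[of "2 * i" "2 * j"] by simp
    qed
    show "p ` {..<k} = P"
    proof (intro equalityI subsetI)
      fix x assume "x \<in> P"
      then have "Inl x \<in> c ` {..<2 * k}" using im by (simp add: P_def)
      then obtain i where i: "i < 2 * k" "c i = Inl x" by force
      then have "even i" using cycle_isl[OF c(1), of i] c(3) by simp
      then have "p (i div 2) = x" using i p[of "i div 2"] by simp
      then show "x \<in> p ` {..<k}" using i by (intro image_eqI[of _ _ "i div 2"]) auto
    next
      fix x assume "x \<in> p ` {..<k}"
      then obtain i where "x = p i" by blast
      then show "x \<in> P" using p[of i] unfolding P_def by (metis mem_Collect_eq rangeI)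
    qed
  qed
  have bl: "bij_betw l {..<k} L"
    unfolding bij_betw_def
  proof
    show "inj_on l {..<k}"
    proof (rule inj_onI)
      fix i j assume "i \<in> {..<k}" "j \<in> {..<k}" "l i = l j"
      then show "i = j" using l[of i] l[of j] eq[of "2 * i + 1" "2 * j + 1"] by simp
    qed
    show "l ` {..<k} = L"
    proof (intro equalityI subsetI)
      fix x assume "x \<in> L"
      then have "Inr x \<in> c ` {..<2 * k}" using im by (simp add: L_def)
      then obtain i where i: "i < 2 * k" "c i = Inr x" by force
      then have "odd i" using cycle_isl[OF c(1), of i] c(3) by auto
      then have "l (i div 2) = x" using i l[of "i div 2"] by simp
      then show "x \<in> l ` {..<k}" using i by (intro image_eqI[of _ _ "i div 2"]) auto
    next
      fix x assume "x \<in> l ` {..<k}"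
      then obtain i where "x = l i" by blast
      then show "x \<in> L" using l[of i] unfolding L_def by (metis mem_Collect_eq rangeI)
    qed
  qed
  have inc: "inc H (p i) (l j) \<longleftrightarrow> i = j \<or> i = (j + 1) mod k" if ij: "i < k" "j < k" for i j
  proof -
    have in': "p i \<in> P" "l j \<in> L" using bp bl ij by (auto simp: bij_betw_def)
    have cadj: "adj G (c i) (c (Suc i))" for i using c(1) unfolding cycle_def by blast
    have m: "Suc (2 * j + 1) mod (2 * k) = 2 * ((j + 1) mod k)"
    proof -
      have "Suc (2 * j + 1) = 2 * (j + 1)" by simp
      then show ?thesis by (simp only: mult_mod_right)
    qed
    show ?thesis
    proof
      assume "inc H (p i) (l j)"
      then have "adj G (c (2 * i)) (c (2 * j + 1))" using p l by (simp add: H_def)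
      then have "2 * j + 1 = Suc (2 * i) mod (2 * k) \<or> 2 * i = Suc (2 * j + 1) mod (2 * k)"
        using ij by (intro chordless) auto
      then show "i = j \<or> i = (j + 1) mod k" using m ij by auto
    next
      assume "i = j \<or> i = (j + 1) mod k"
      then have "adj G (c (2 * j + 1)) (c (2 * i))"
      proof
        assume "i = j" then show ?thesis
          using cadj[of "2 * j"] adj_sym by simp
      next
        assume "i = (j + 1) mod k"
        then have "2 * i = Suc (2 * j + 1) mod (2 * k)" using m by simp
        then have "c (2 * i) = c (Suc (2 * j + 1))" using cycle_mod[OF c(1)] by metis
        then show ?thesis using cadj[of "2 * j + 1"] by simp
      qed
      then show "inc H (p i) (l j)" using p l in' by (simp add: H_def)
    qed
  qed
  have "p 0 \<in> P" "l 0 \<in> L" using bp bl c(2) by (auto simp: bij_betw_def)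
  then have "point_line_geometry H" by (auto simp: point_line_geometry_def H_def)
  moreover have "subgeometry H G" using PG by (auto simp: subgeometry_def H_def)
  moreover have "elements H = range c"
    by (rule set_eqI; rename_tac z; case_tac z) (auto simp: elements_def H_def P_def L_def)
  ultimately show ?thesis using bp bl inc
    by (intro exI[of _ H]) (auto simp: ordinary_polygon_def H_def intro!: exI[of _ p] exI[of _ l])
qed

definition chordless :: "('v \<Rightarrow> 'v \<Rightarrow> bool) \<Rightarrow> (nat \<Rightarrow> 'v) \<Rightarrow> bool" where
  "chordless E c \<longleftrightarrow> (\<forall>i j. E (c i) (c j) \<longrightarrow> c j = c (Suc i) \<or> c i = c (Suc j))"

lemma cycle_polygon:
  assumes plg: "point_line_geometry G" and c: "cycle (adj G) (2 * k) c" "2 \<le> k"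
    and ch: "chordless (adj G) c"
  shows "\<exists>H. subgeometry H G \<and> ordinary_polygon k H \<and> elements H = range c"
proof -
  have aux: "\<exists>H. subgeometry H G \<and> ordinary_polygon k H \<and> elements H = range d"
    if d: "cycle (adj G) (2 * k) d" "chordless (adj G) d" "isl (d 0)" for d
  proof (rule cycle_polygon_aux[OF plg d(1) c(2) d(3)])
    fix i j assume ij: "i < 2 * k" "j < 2 * k" "adj G (d i) (d j)"
    then have "d j = d (Suc i) \<or> d i = d (Suc j)" using d(2) by (auto simp: chordless_def)
    then show "j = Suc i mod (2 * k) \<or> i = Suc j mod (2 * k)"
      using ij c(2) cycle_eq_iff[OF d(1)] by simp
  qed
  show ?thesis
  proof (cases "isl (c 0)")
    case False
    have "\<not> isl (c 0) \<longrightarrow> isl (c 1)" using cycle_isl[OF c(1), of 1] by simp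
    moreover have "cycle (adj G) (2 * k) (\<lambda>i. c (i + 1))" using c by (intro cycle_shift) auto
    moreover have "chordless (adj G) (\<lambda>i. c (i + 1))" using ch by (simp add: chordless_def)
    moreover have "range (\<lambda>i. c (i + 1)) = range c"
    proof (intro equalityI subsetI)
      fix z assume "z \<in> range c"
      then obtain i where "z = c i" by blast
      then have "z = c (i + (2 * k - 1) + 1)" using c unfolding cycle_def by simp
      then show "z \<in> range (\<lambda>i. c (i + 1))" by blast
    qed auto
    ultimately show ?thesis using aux[of "\<lambda>i. c (i + 1)"] False by simp
  qed (use aux c ch in blast)
qed

text \<open>A chord closes the arc between its ends to a shorter cycle. This gives the descent from
  arbitrary cycles to chordless ones, the only ones that ordinary polygons see.\<close>

lemma cycle_shorten:
  assumes c: "cycle E n c" "3 \<le> n" and sym: "\<And>x y. E x y \<Longrightarrow> E y x" and irr: "\<And>x. \<not> E x x"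
    and ch: "\<not> chordless E c"
  shows "\<exists>n' c'. cycle E n' c' \<and> 3 \<le> n' \<and> n' < n"
proof -
  have short: "\<exists>n' c'. cycle E n' c' \<and> 3 \<le> n' \<and> n' < n"
    if ij: "i < j" "j < n" "E (c i) (c j)" "c j \<noteq> c (Suc i)" "c i \<noteq> c (Suc j)" for i j
  proof -
    have "j \<noteq> Suc i" using ij by auto
    \<comment> \<open>Otherwise the chord would be the closing edge, and the arc the whole
      cycle.\<close>
    moreover have "\<not> (i = 0 \<and> j = n - 1)"
      using ij cycle_mod[OF c(1), of n] c(2) by auto
    moreover have "cycle E (j - i + 1) (\<lambda>k. c (i + k mod (j - i + 1)))"
    proof (rule cycleI)
      have inj: "inj_on c {..<n}" using c unfolding cycle_def by blast
      show "inj_on (\<lambda>k. c (i + k)) {..<j - i + 1}"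
      proof (rule inj_onI)
        fix a b assume "a \<in> {..<j - i + 1}" "b \<in> {..<j - i + 1}" "c (i + a) = c (i + b)"
        then show "a = b" using inj_onD[OF inj, of "i + a" "i + b"] ij by auto
      qed
      show "E (c (i + (j - i + 1 - 1))) (c (i + 0))" using ij sym by auto
      show "E (c (i + k)) (c (i + Suc k))" for k
        using c(1) unfolding cycle_def by simp
    qed simp
    ultimately show ?thesis using ij
      by (intro exI[of _ "j - i + 1"] exI[of _ "\<lambda>k. c (i + k mod (j - i + 1))"]) linarith
  qed
  obtain i' j' where "E (c i') (c j')" "c j' \<noteq> c (Suc i')" "c i' \<noteq> c (Suc j')"
    using ch by (auto simp: chordless_def)
  moreover have "c (Suc (k mod n)) = c (Suc k)" for k
    using cycle_mod[OF c(1), of "Suc (k mod n)"] cycle_mod[OF c(1), of "Suc k"]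
    by (simp add: mod_Suc_eq)
  ultimately obtain i j where ij: "i < n" "j < n" "E (c i) (c j)" "c j \<noteq> c (Suc i)" "c i \<noteq> c (Suc j)"
    using cycle_mod[OF c(1)] c(2) mod_less_divisor[of n]
    by (metis gr_zeroI not_numeral_le_zero)
  then have "i \<noteq> j" using irr by auto
  then show ?thesis using short[of i j] short[of j i] ij sym by (meson linorder_neqE_nat)
qed

lemma cycle_nbw:
  assumes c: "cycle E n c" "3 \<le> n" shows "nbw E (map c [i..<j])"
proof (induction "j - i" arbitrary: i)
  case (Suc d)
  show ?case
  proof (cases "Suc i < j")
    case True
    then have eq: "[i..<j] = i # [Suc i..<j]" "[Suc i..<j] = Suc i # [Suc (Suc i)..<j]"
      by (auto simp: upt_conv_Cons)
    have "c i \<noteq> c (Suc (Suc i))"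
    proof
      assume "c i = c (Suc (Suc i))"
      then have "i mod n = (i + 2) mod n" using cycle_eq_iff[OF c(1)] c(2) by auto
      then have "n dvd 2" using mod_eq_dvd_iff_nat[of i "i + 2" n] by simp
      then show False using c(2) by (auto dest: dvd_imp_le)
    qed
    moreover have "E (c i) (c (Suc i))" using c(1) unfolding cycle_def by blast
    moreover have "nbw E (map c [Suc i..<j])" using Suc by (intro Suc.hyps) auto
    ultimately show ?thesis unfolding eq
      by (cases "Suc (Suc i) < j") (auto simp: nbw_Cons upt_conv_Cons)
  next
    case False
    then have "j = Suc i" using Suc by simp
    then show ?thesis by simp
  qed
qed simp

lemma (in girth12) cycle_length: "cycle E n c \<Longrightarrow> 3 \<le> n \<Longrightarrow> 12 \<le> n"
proof (rule ccontr)
  assume c: "cycle E n c" "3 \<le> n" "\<not> 12 \<le> n"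
  have "c n = c 0" using cycle_mod[OF c(1), of n] by simp
  moreover have "distinct (map c [0..<Suc n])"
    using cycle_nbw[OF c(1,2), of 0 "Suc n"] c(3) by (intro girth) auto
  then have "inj_on c {0..<Suc n}" unfolding distinct_map set_upt by blast
  ultimately show False using c(2) inj_onD[of c "{0..<Suc n}" n 0] by simp
qed

lemma (in girth12) cycle12_chordless:
  assumes "cycle E 12 c" "\<And>x. \<not> E x x" shows "chordless E c"
  using cycle_shorten[OF assms(1) _ sym assms(2)] cycle_length by fastforce

text \<open>Induction on the length: a chord yields a shorter cycle, and a chordless cycle is an
  ordinary polygon with half as many points, excluded by definition.\<close>

lemma weak_polygon_cycle:
  assumes "weak_generalized_polygon m G" "cycle (adj G) n c" "3 \<le> n"
  shows "2 * m \<le> n"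
  using assms(2,3)
proof (induction n arbitrary: c rule: less_induct)
  case (less n)
  show ?case
  proof (rule ccontr)
    assume n: "\<not> 2 * m \<le> n"
    have "chordless (adj G) c"
      using cycle_shorten[OF less.prems adj_sym adj_irrefl] less.IH n by fastforce
    moreover obtain k where k: "n = 2 * k" using cycle_even less.prems(1) by blast
    ultimately obtain H where "subgeometry H G" "ordinary_polygon k H"
      using cycle_polygon[of G k c] less.prems assms(1) by (auto simp: weak_generalized_polygon_def)
    then show False using assms(1) n k less.prems by (auto simp: weak_generalized_polygon_def)
  qed
qed

lemma weak_hexagon_girth12:
  assumes "weak_generalized_polygon 6 G" shows "girth12 (adj G)"
proof unfold_locales
  fix xs assume "nbw (adj G) xs" "length xs \<le> 12"
  then show "distinct xs"
    using nbw_cycle[of "adj G" xs] weak_polygon_cycle[OF assms] adj_irrefl[of G] by fastforce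
qed (rule adj_sym)

lemma weak_hexagon_apartment:
  assumes "weak_generalized_polygon 6 G" "x \<in> elements G" "y \<in> elements G"
  shows "\<exists>c. cycle (adj G) 12 c \<and> c 0 = x \<and> y \<in> range c"
proof -
  obtain H where H: "subgeometry H G" "ordinary_polygon 6 H" "x \<in> elements H" "y \<in> elements H"
    using assms by (fastforce simp: weak_generalized_polygon_def)
  then obtain c where c: "cycle (adj G) 12 c" "elements H = range c"
    using polygon_cycle[of H G 6] by auto
  obtain i where i: "x = c i" using H c by auto
  obtain j where j: "y = c j" using H c by auto
  have "cycle (adj G) 12 (\<lambda>k. c (k + i))" using c by (intro cycle_shift) auto
  moreover have "c (j + 12 * i) = c j"
    using cycle_mod[OF c(1), of "j + 12 * i"] cycle_mod[OF c(1), of j] by simp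
  then have "y = c ((j + 11 * i) + i)" using j by (simp add: algebra_simps)
  then have "y \<in> range (\<lambda>k. c (k + i))" by blast
  ultimately show ?thesis using i by (intro exI[of _ "\<lambda>k. c (k + i)"]) auto
qed

lemma successively_isl:
  "successively (adj G) (x # xs) \<Longrightarrow> isl (last (x # xs)) \<longleftrightarrow> (isl x \<longleftrightarrow> even (length xs))"
proof (induction xs arbitrary: x)
  case (Cons y xs)
  then show ?case using adj_isl[of G x y] by auto
qed simp

lemma weak_hexagonI:
  assumes plg: "point_line_geometry G" and g: "girth12 (adj G)"
    and ap: "\<And>x y. x \<in> elements G \<Longrightarrow> y \<in> elements G \<Longrightarrow>
      \<exists>c. cycle (adj G) 12 c \<and> x \<in> range c \<and> y \<in> range c"
  shows "weak_generalized_polygon 6 G"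
  unfolding weak_generalized_polygon_def
proof (intro conjI ballI allI impI)
  fix x y assume "x \<in> elements G" "y \<in> elements G"
  then obtain c where c: "cycle (adj G) 12 c" "x \<in> range c" "y \<in> range c" using ap by blast
  have "chordless (adj G) c"
    using girth12.cycle12_chordless[OF g c(1)] adj_irrefl by metis
  then show "\<exists>H. subgeometry H G \<and> ordinary_polygon 6 H \<and> x \<in> elements H \<and> y \<in> elements H"
    using cycle_polygon[OF plg, of 6 c] c by auto
next
  fix k :: nat assume k: "2 \<le> k \<and> k < 6"
  show "\<not> (\<exists>H. subgeometry H G \<and> ordinary_polygon k H)"
    using polygon_cycle[of _ G k] girth12.cycle_length[OF g, of "2 * k"] k by fastforce
qed (use plg in auto)

text \<open>The distance is 1, 3 or 5; shorter walks are padded by going back and forth over an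
  edge. The fixed length is what makes images comparable with a path of five edges.\<close>

lemma weak_hexagon_walk:
  assumes "weak_generalized_polygon 6 G" "x \<in> elements G" "y \<in> elements G" "isl x \<noteq> isl y"
  shows "\<exists>xs. successively (adj G) xs \<and> length xs = 6 \<and> hd xs = x \<and> last xs = y"
proof -
  obtain c j' where c: "cycle (adj G) 12 c" "c 0 = x" and j': "y = c j'"
    using weak_hexagon_apartment[OF assms(1-3)] by auto
  define j where "j = j' mod 12"
  have j: "y = c j" "j < 12" using cycle_mod[OF c(1), of j'] j' by (auto simp: j_def)
  have "odd j" using cycle_isl[OF c(1), of j] c(2) j assms(4) by auto
  then have "j \<in> {1, 3, 5, 7, 9, 11}" using j(2) by (simp; presburger)
  moreover have a: "adj G (c i) (c (Suc i))" for i using c(1) unfolding cycle_def by blast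
  note a' = a[of 0] a[of 1] a[of 2] a[of 3] a[of 4] a[of 7] a[of 8] a[of 9] a[of 10] a[of 11]
  \<comment> \<open>From \<open>j = 7\<close> on, the shorter way round runs down from index
    12.\<close>
  have "c 12 = x" using cycle_mod[OF c(1), of 12] c(2) by simp
  ultimately show ?thesis
    using a' adj_sym[of G] c(2) j
    apply (elim insertE emptyE)
    subgoal by (intro exI[of _ "[c 0, c 1, c 0, c 1, c 0, c 1]"]) (simp add: eval_nat_numeral)
    subgoal by (intro exI[of _ "[c 0, c 1, c 0, c 1, c 2, c 3]"]) (simp add: eval_nat_numeral)
    subgoal by (intro exI[of _ "[c 0, c 1, c 2, c 3, c 4, c 5]"]) (simp add: eval_nat_numeral)
    subgoal by (intro exI[of _ "[c 12, c 11, c 10, c 9, c 8, c 7]"]) (simp add: eval_nat_numeral)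
    subgoal by (intro exI[of _ "[c 12, c 11, c 10, c 9, c 10, c 9]"]) (simp add: eval_nat_numeral)
    subgoal by (intro exI[of _ "[c 12, c 11, c 12, c 11, c 12, c 11]"]) (simp add: eval_nat_numeral)
    done
qed

section \<open>Fibre degrees of an epimorphism\<close>

locale hexagon_epi =
  fixes S :: "('p, 'l) geometry" and G :: "('q, 'm) geometry" and f :: "'p + 'l \<Rightarrow> 'q + 'm"
  assumes S: "weak_generalized_polygon 6 S" and G: "weak_generalized_polygon 6 G"
    and f_adj: "adj S x y \<Longrightarrow> adj G (f x) (f y)"
    and f_isl: "isl (f x) \<longleftrightarrow> isl x"
    and f_onto: "f ` elements S = elements G"
    and fin: "finite {y. adj S x y}"
begin

sublocale S: girth12 "adj S" by (rule weak_hexagon_girth12[OF S])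
sublocale G: girth12 "adj G" by (rule weak_hexagon_girth12[OF G])

lemma S_elements: "adj S x y \<Longrightarrow> x \<in> elements S" "adj S x y \<Longrightarrow> y \<in> elements S"
  using adj_elements S by (auto simp: weak_generalized_polygon_def)

lemma G_elements: "adj G x y \<Longrightarrow> x \<in> elements G" "adj G x y \<Longrightarrow> y \<in> elements G"
  using adj_elements G by (auto simp: weak_generalized_polygon_def)

lemma lift:
  assumes g: "nbw (adj G) [g0, g1, g2, g3, g4, g5]"
    and xy: "x \<in> elements S" "y \<in> elements S" "f x = g0" "f y = g5"
  obtains a b c d where "adj S x a" "adj S a b" "adj S b c" "adj S c d" "adj S d y"
    "f a = g1" "f b = g2" "f c = g3" "f d = g4"
proof -
  have "isl g0 \<noteq> isl g5" 
    using g adj_isl[of G g0 g1] adj_isl[of G g1 g2] adj_isl[of G g2 g3] adj_isl[of G g3 g4] adj_isl[of G g4 g5]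
    by (simp add: nbw_Cons)
  then have "isl x \<noteq> isl y" using f_isl[of x] f_isl[of y] xy by simp
  then obtain xs where xs: "successively (adj S) xs" "length xs = 6" "hd xs = x" "last xs = y"
    using weak_hexagon_walk[OF S xy(1,2)] by blast
  have "xs \<noteq> []" using xs(2) by auto
  have "map f xs = [g0, g1, g2, g3, g4, g5]"
  proof (rule G.walk_unique[OF g])
    show "successively (adj G) (map f xs)"
      using xs(1) f_adj by (auto simp: successively_map intro: successively_mono)
  qed (use xs xy \<open>xs \<noteq> []\<close> in \<open>simp_all add: hd_map last_map\<close>)
  moreover obtain u0 u1 u2 u3 u4 u5 where "xs = [u0, u1, u2, u3, u4, u5]"
    using xs(2) by (auto simp: length_Suc_conv eval_nat_numeral)
  ultimately show ?thesis using xs that by auto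
qed

definition N :: "'p + 'l \<Rightarrow> 'q + 'm \<Rightarrow> nat" where
  "N x w = card {u. adj S x u \<and> f u = w}"

lemma fin_N: "finite {u. adj S x u \<and> f u = w}"
  using fin[of x] by (rule rev_finite_subset) auto

lemma nbw_lift: "successively (adj S) xs \<Longrightarrow> nb (map f xs) \<Longrightarrow> nbw (adj S) xs"
  by (auto simp: nbw_def intro: nb_map)

text \<open>Send \<open>u\<close> to the last vertex before \<open>y\<close> on a lift from
  \<open>u\<close> to \<open>y\<close>. This is injective, since two walks of five edges from
  \<open>x\<close> to the same vertex agree.\<close>

lemma N_le:
  assumes g: "nbw (adj G) [g0, g1, g2, g3, g4, g5, g6]"
    and xy: "x \<in> elements S" "y \<in> elements S" "f x = g0" "f y = g6"
  shows "N x g1 \<le> N y g5"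
proof -
  have "\<exists>z. adj S y z \<and> f z = g5 \<and> (\<exists>a b c. nbw (adj S) [x, u, a, b, c, z])"
    if u: "adj S x u" "f u = g1" for u
  proof -
    have g': "nbw (adj G) [g1, g2, g3, g4, g5, g6]" using g by (simp add: nbw_Cons)
    obtain a b c d where l: "adj S u a" "adj S a b" "adj S b c" "adj S c d" "adj S d y"
      "f a = g2" "f b = g3" "f c = g4" "f d = g5"
      using lift[OF g' _ xy(2) u(2) xy(4)] S_elements u by metis
    have "nbw (adj S) [x, u, a, b, c, d]"
      by (rule nbw_lift) (use l u xy g in \<open>auto simp: nbw_Cons\<close>)
    then show ?thesis using l S.sym by blast
  qed
  then obtain h where h: "\<And>u. adj S x u \<Longrightarrow> f u = g1 \<Longrightarrow> adj S y (h u) \<and> f (h u) = g5 \<and>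
      (\<exists>a b c. nbw (adj S) [x, u, a, b, c, h u])" by metis
  have "inj_on h {u. adj S x u \<and> f u = g1}"
  proof (rule inj_onI, clarify)
    fix u u' assume u: "adj S x u" "g1 = f u" "adj S x u'" "f u' = f u" "h u = h u'"
    then obtain a b c a' b' c' where "nbw (adj S) [x, u, a, b, c, h u]" "nbw (adj S) [x, u', a', b', c', h u]"
      using h[of u] h[of u'] by metis
    then have "[x, u, a, b, c, h u] = [x, u', a', b', c', h u]" by (rule S.nbw_unique') auto
    then show "u = u'" by simp
  qed
  moreover have "h ` {u. adj S x u \<and> f u = g1} \<subseteq> {z. adj S y z \<and> f z = g5}" using h by auto
  ultimately show ?thesis unfolding N_def using fin_N by (rule card_inj_on_le)
qed

lemma N_eq:
  assumes g: "nbw (adj G) [g0, g1, g2, g3, g4, g5, g6]"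
    and xy: "x \<in> elements S" "y \<in> elements S" "f x = g0" "f y = g6"
  shows "N x g1 = N y g5"
  using N_le[OF assms] N_le[of g6 g5 g4 g3 g2 g1 g0 y x] G.nbw_rev[OF g] xy by simp

lemma N_pos: "adj S x u \<Longrightarrow> 1 \<le> N x (f u)"
  unfolding N_def using fin_N[of x "f u"] by (auto simp: Suc_le_eq card_gt_0_iff)

lemma N_ge2: "2 \<le> N x w \<Longrightarrow> \<exists>u'. adj S x u' \<and> f u' = w \<and> u' \<noteq> u"
proof (rule ccontr)
  assume N: "2 \<le> N x w" and "\<not> ?thesis"
  then have "{u. adj S x u \<and> f u = w} \<subseteq> {u}" by auto
  then have "N x w \<le> card {u}" unfolding N_def by (intro card_mono) auto
  then show False using N by simp
qed

lemma N_1: "N x w = 1 \<Longrightarrow> adj S x u \<Longrightarrow> f u = w \<Longrightarrow> adj S x u' \<Longrightarrow> f u' = w \<Longrightarrow> u = u'"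
  unfolding N_def by (auto simp: card_1_singleton_iff) (metis (mono_tags) mem_Collect_eq singletonD)

end

section \<open>Neighbour counts along a 12-cycle of the image\<close>

locale hexagon_epi_cycle = hexagon_epi S G f
  for S :: "('p, 'l) geometry" and G :: "('q, 'm) geometry" and f +
  fixes v :: "nat \<Rightarrow> 'q + 'm"
  assumes v: "cycle (adj G) 12 v"
begin

definition X :: "nat \<Rightarrow> 'p + 'l \<Rightarrow> bool" where
  "X i x \<longleftrightarrow> x \<in> elements S \<and> f x = v i"

text \<open>By \<open>N_up\<close> the chosen element does not matter.\<close>

definition p :: "nat \<Rightarrow> nat" where
  "p i = N (SOME x. X i x) (v (i + 1))"

lemma v_adj: "adj G (v i) (v (Suc i))"
  using v unfolding cycle_def by blast

lemma v12 [simp]: "v (i + 12) = v i"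
  using v unfolding cycle_def by blast

lemma v_neq: "0 < k \<Longrightarrow> k < 12 \<Longrightarrow> v i \<noteq> v (i + k)"
proof
  assume k: "0 < k" "k < 12" "v i = v (i + k)"
  then have "(i + k) mod 12 = i mod 12" using cycle_eq_iff[OF v, of i "i + k"] by simp
  then have "12 dvd k" using mod_eq_dvd_iff_nat[of i "i + k" 12] by simp
  then show False using k by (auto dest: dvd_imp_le)
qed

lemma v_neq2: "j = i + 2 \<Longrightarrow> v i \<noteq> v j"
  using v_neq[of 2 i] by simp

lemma nbw_v: "nbw (adj G) (map v [i..<j])"
  using cycle_nbw[OF v] by simp

lemma nbw_v6: "nbw (adj G) [v i, v (i+1), v (i+2), v (i+3), v (i+4), v (i+5)]"
  using nbw_v[of i "i + 6"] by (simp add: eval_nat_numeral)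

lemma nbw_v7: "nbw (adj G) [v i, v (i+1), v (i+2), v (i+3), v (i+4), v (i+5), v (i+6)]"
  using nbw_v[of i "i + 7"] by (simp add: eval_nat_numeral)

lemma nbw_v6': "nbw (adj G) [v (i+5), v (i+4), v (i+3), v (i+2), v (i+1), v i]"
  using G.nbw_rev[OF nbw_v6[of i]] by simp

lemma X12 [simp]: "X (i + 12) = X i"
  by (auto simp: X_def)

lemma X_ex: "\<exists>x. X i x"
  using G_elements(1)[OF v_adj[of i]] f_onto unfolding X_def by (metis imageE)

text \<open>All elements over \<open>v i\<close> are compared with one and the same \<open>y\<close>
  over the opposite vertex \<open>v (i + 6)\<close>.\<close>

lemma N_up: "X i x \<Longrightarrow> N x (v (i + 1)) = p i"
proof -
  assume x: "X i x"
  then have x': "X i (SOME x. X i x)" by (rule someI)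
  obtain y where "X (i + 6) y" using X_ex by blast
  then show ?thesis
    using N_eq[OF nbw_v7[of i], of _ y] x x' by (simp add: X_def p_def)
qed

lemma p12 [simp]: "p (i + 12) = p i"
proof -
  obtain x where "X i x" using X_ex by blast
  then show ?thesis using N_up[of i x] N_up[of "i + 12" x] v12[of "i + 1"] by (simp add: algebra_simps)
qed

text \<open>The path of six edges upwards from \<open>v (i + 7)\<close> enters its end
  \<open>v (i + 13)\<close>, which is \<open>v (i + 1)\<close>, from \<open>v i\<close>. So counting
  downwards is counting upwards at the opposite vertex.\<close>

lemma N_down: "X (i + 1) x \<Longrightarrow> N x (v i) = p (i + 7)"
proof -
  assume x: "X (i + 1) x"
  obtain y where y: "X (i + 7) y" using X_ex by blast
  have "N y (v (i + 7 + 1)) = N x (v (i + 7 + 5))"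
    using N_eq[OF nbw_v7[of "i + 7"], of y x] x y v12[of "i + 1"]
    by (simp add: X_def algebra_simps)
  then show ?thesis using N_up[OF y] v12[of i] by (simp add: algebra_simps)
qed

text \<open>Only fibres of single elements are known to be nonempty; the neighbour is the second
  vertex of a lift ending in any element over \<open>v (i + 5)\<close>.\<close>

lemma step_up: "X i x \<Longrightarrow> \<exists>u. adj S x u \<and> X (i + 1) u"
proof -
  assume x: "X i x"
  obtain y where "X (i + 5) y" using X_ex by blast
  then show ?thesis
    using lift[OF nbw_v6[of i], of x y] x S_elements unfolding X_def by metis
qed

lemma step_down: "X (i + 1) x \<Longrightarrow> \<exists>u. adj S x u \<and> X i u"
proof -
  assume x: "X (i + 1) x"
  have e: "v (i + 8 + 5) = v (i + 1)" "v (i + 8 + 4) = v i"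
    using v12[of i] v12[of "i + 1"] by (simp_all add: algebra_simps)
  obtain y where "X (i + 8) y" using X_ex by blast
  then show ?thesis
    using lift[OF nbw_v6'[of "i + 8"], of x y] x S_elements unfolding X_def e by metis
qed

lemma p_pos: "1 \<le> p i"
proof -
  obtain x where x: "X i x" using X_ex by blast
  then obtain u where "adj S x u" "X (i + 1) u" using step_up by blast
  then show ?thesis using N_pos[of x u] N_up[OF x] by (simp add: X_def)
qed

lemma up_ge2: "X i x \<Longrightarrow> 2 \<le> p i \<Longrightarrow> \<exists>u'. adj S x u' \<and> X (i + 1) u' \<and> u' \<noteq> u"
  using N_ge2[of x "v (i + 1)"] N_up[of i x] S_elements unfolding X_def by metis

lemma down_ge2: "X (i + 1) x \<Longrightarrow> 2 \<le> p (i + 7) \<Longrightarrow> \<exists>u'. adj S x u' \<and> X i u' \<and> u' \<noteq> u"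
  using N_ge2[of x "v i"] N_down[of i x] S_elements unfolding X_def by metis

lemma down_unique:
  "X (i + 1) x \<Longrightarrow> p (i + 7) = 1 \<Longrightarrow> adj S x u \<Longrightarrow> X i u \<Longrightarrow> adj S x u' \<Longrightarrow> X i u' \<Longrightarrow> u = u'"
  using N_1[of x "v i" u u'] N_down[of i x] by (simp add: X_def)

text \<open>The middle of the walk is left free: it may be a zigzag over an edge of the cycle or
  visit a fibre outside the cycle. Both occur below.\<close>

definition detour :: "nat \<Rightarrow> bool" where
  "detour i \<longleftrightarrow> (\<exists>x u1 u2 u3 u4 u5 y. X i x \<and> X (i + 4) y \<and> f u1 = v (i + 1) \<and> f u5 = v (i + 3) \<and>
     nbw (adj S) [x, u1, u2, u3, u4, u5, y])"

lemma detour_Suc: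
  "detour (i + 1) \<longleftrightarrow> (\<exists>x u1 u2 u3 u4 u5 y. X (i + 1) x \<and> X (i + 5) y \<and> f u1 = v (i + 2) \<and>
     f u5 = v (i + 4) \<and> nbw (adj S) [x, u1, u2, u3, u4, u5, y])"
proof -
  have "i + 1 + 4 = i + 5" "i + 1 + 1 = i + 2" "i + 1 + 3 = i + 4" by simp_all
  then show ?thesis unfolding detour_def by presburger
qed

text \<open>Neighbours of \<open>x\<close> over \<open>v i\<close> project injectively to neighbours
  of \<open>y\<close> over \<open>v (i + 4)\<close>. The neighbour \<open>u5\<close> is missed,
  because it belongs to \<open>u1\<close>, which lies over \<open>v (i + 2)\<close>.\<close>

lemma detour_less:
  assumes "detour (i + 1)" shows "p (i + 7) < p (i + 11)"
proof -
  obtain x u1 u2 u3 u4 u5 y where x: "X (i + 1) x" and y: "X (i + 5) y"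
    and f1: "f u1 = v (i + 2)" and f5: "f u5 = v (i + 4)"
    and w: "nbw (adj S) [x, u1, u2, u3, u4, u5, y]"
    using assms unfolding detour_Suc by blast
  have f: "f x = v (i + 1)" "f y = v (i + 5)" "x \<in> elements S" "y \<in> elements S"
    using x y by (auto simp: X_def)
  have v2': "v i \<noteq> v (i + 2)" "v (i + 1) \<noteq> v (i + 3)" "v (i + 2) \<noteq> v (i + 4)" "v (i + 3) \<noteq> v (i + 5)"
    by (rule v_neq2; simp)+
  have "\<exists>z. adj S y z \<and> f z = v (i + 4) \<and> (\<exists>a b c. nbw (adj S) [x, u, a, b, c, z])"
    if u: "adj S x u" "f u = v i" for u
  proof -
    obtain a b c z where l: "adj S u a" "adj S a b" "adj S b c" "adj S c z" "adj S z y"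
      "f a = v (i + 1)" "f b = v (i + 2)" "f c = v (i + 3)" "f z = v (i + 4)"
      by (rule lift[OF nbw_v6[of i] S_elements(2)[OF u(1)] f(4) u(2) f(2)])
    \<comment> \<open>A lift returning to \<open>x\<close> would give a walk of four edges from
      \<open>x\<close> to \<open>y\<close> beside the detour of six, too few edges in total for
      girth 12.\<close>
    have "x \<noteq> a"
    proof
      assume "x = a"
      then have "nbw (adj S) [x, b, c, z, y]"
        using l f v2' by (intro nbw_lift) auto
      then have "[x, b, c, z, y] = [x, u1, u2, u3, u4, u5, y]"
        using w by (rule S.nbw_unique') auto
      then show False by simp
    qed
    moreover have "u \<noteq> b" "a \<noteq> c" "b \<noteq> z" using l u v2' by auto
    ultimately have "nbw (adj S) [x, u, a, b, c, z]" using l u by (simp add: nbw_Cons)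
    then show ?thesis using l(9) S.sym[OF l(5)] by blast
  qed
  then obtain h where h: "\<And>u. adj S x u \<Longrightarrow> f u = v i \<Longrightarrow> adj S y (h u) \<and> f (h u) = v (i + 4) \<and>
      (\<exists>a b c. nbw (adj S) [x, u, a, b, c, h u])" by metis
  let ?A = "{u. adj S x u \<and> f u = v i}" and ?B = "{z. adj S y z \<and> f z = v (i + 4)}"
  have w': "nbw (adj S) [x, u1, u2, u3, u4, u5]" and yu5: "adj S y u5"
    using w S.sym by (auto simp: nbw_Cons)
  have eq: "u = u'" if uA: "u \<in> ?A" and w2: "nbw (adj S) [x, u', a', b', c', h u]" for u u' a' b' c'
  proof -
    obtain a b c where "nbw (adj S) [x, u, a, b, c, h u]" using h[of u] uA by auto
    then have "[x, u, a, b, c, h u] = [x, u', a', b', c', h u]"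
      using w2 by (rule S.nbw_unique') auto
    then show "u = u'" by simp
  qed
  have inj: "inj_on h ?A"
  proof (rule inj_onI)
    fix u u' assume u: "u \<in> ?A" "u' \<in> ?A" "h u = h u'"
    then show "u = u'" using eq[OF u(1)] h[of u'] by auto
  qed
  have "u5 \<notin> h ` ?A"
  proof
    assume "u5 \<in> h ` ?A"
    then obtain u where u: "u \<in> ?A" "u5 = h u" by blast
    then have "u = u1" using eq[OF u(1)] w' by auto
    then show False using u f1 v2' by auto
  qed
  then have "h ` ?A \<subset> ?B" using h yu5 f5 by auto
  then have "card (h ` ?A) < card ?B" using fin_N by (rule psubset_card_mono[rotated])
  then have "N x (v i) < N y (v (i + 4))" using card_image[OF inj] by (simp add: N_def)
  then show ?thesis using N_down[of i x] N_down[of "i + 4" y] x y by (simp add: algebra_simps)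
qed

lemma detour_less': "detour (i + 6) \<Longrightarrow> p i < p (i + 4)"
  using detour_less[of "i + 5"] p12[of i] p12[of "i + 4"] by (simp add: algebra_simps)

text \<open>Let \<open>z\<close> over \<open>v (i + 6)\<close> be a neighbour of \<open>y\<close>.
  Since \<open>p i = 1\<close>, the lift from \<open>x\<close> to \<open>z\<close> has to pass
  through \<open>y\<close>. So \<open>y\<close> is four edges away from \<open>x\<close>, and a
  detour of six edges cannot exist as well.\<close>

lemma no_detour:
  assumes "p i = 1" shows "\<not> detour (i + 1)"
proof
  assume "detour (i + 1)"
  then obtain x u1 u2 u3 u4 u5 y where x: "X (i + 1) x" and y: "X (i + 5) y"
    and w: "nbw (adj S) [x, u1, u2, u3, u4, u5, y]"
    unfolding detour_Suc by blast
  have nb6: "nbw (adj G) [v (i+1), v (i+2), v (i+3), v (i+4), v (i+5), v (i+6)]"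
    using nbw_v6[of "i + 1"] by (simp add: numeral_eq_Suc)
  have e: "i + 5 + 1 = i + 6" by simp
  obtain z where z: "adj S y z" "X (i + 6) z" using step_up[OF y] unfolding e by blast
  have xz: "x \<in> elements S" "z \<in> elements S" "f x = v (i + 1)" "f z = v (i + 6)"
    using x z by (simp_all add: X_def)
  obtain a b c d where l: "adj S x a" "adj S a b" "adj S b c" "adj S c d" "adj S d z"
      "f a = v (i + 2)" "f b = v (i + 3)" "f c = v (i + 4)" "f d = v (i + 5)"
    by (rule lift[OF nb6 xz])
  have "X (i + 5) d" using l S_elements by (auto simp: X_def)
  \<comment> \<open>By \<open>N_down\<close>, the number of neighbours of \<open>z\<close> over
    \<open>v (i + 5)\<close> is \<open>p (i + 12)\<close>, which is \<open>p i\<close>.\<close>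
  then have "y = d" using down_unique[of "i + 5" z y d] z y l p12[of i] assms S.sym
    by (simp add: numeral_eq_Suc)
  have v2': "v (i + 1) \<noteq> v (i + 3)" "v (i + 2) \<noteq> v (i + 4)" "v (i + 3) \<noteq> v (i + 5)"
    by (rule v_neq2; simp)+
  have "nbw (adj S) [x, a, b, c, y]"
    using l x y v2' \<open>y = d\<close> by (intro nbw_lift) (auto simp: X_def)
  then have "[x, a, b, c, y] = [x, u1, u2, u3, u4, u5, y]"
    using w by (rule S.nbw_unique') auto
  then show False by simp
qed

end

section \<open>From absent detours to a fibre with one element\<close>

context hexagon_epi_cycle
begin

lemma zigzag:
  assumes "2 \<le> p j" "2 \<le> p (j + 7)"
  obtains a b c d where "X j a" "X (j + 1) b" "X j c" "X (j + 1) d"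
    "adj S a b" "adj S b c" "adj S c d" "a \<noteq> c" "b \<noteq> d"
proof -
  obtain b where b: "X (j + 1) b" using X_ex by blast
  obtain a where a: "adj S b a" "X j a" using step_down[OF b] by blast
  obtain c where c: "adj S b c" "X j c" "c \<noteq> a" using down_ge2[OF b assms(2)] by blast
  obtain d where d: "adj S c d" "X (j + 1) d" "d \<noteq> b" using up_ge2[OF c(2) assms(1)] by blast
  show ?thesis using that[of a b c d] a b c d S.sym by blast
qed

lemma v2: "v j \<noteq> v (j + 2)"
  using v_neq[of 2 j] by simp

lemma X_up: "X i x \<Longrightarrow> j = i + 1 \<Longrightarrow> \<exists>u. adj S x u \<and> X j u"
  using step_up[of i x] by simp

lemma X_down: "X j x \<Longrightarrow> j = i + 1 \<Longrightarrow> \<exists>u. adj S u x \<and> X i u"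
  using step_down[of i x] S.sym by blast

lemma detour_intro:
  "X i x \<Longrightarrow> X (i + 1) u1 \<Longrightarrow> X (i + 3) u5 \<Longrightarrow> X (i + 4) y \<Longrightarrow>
    nbw (adj S) [x, u1, u2, u3, u4, u5, y] \<Longrightarrow> detour i"
  unfolding detour_def X_def by blast

text \<open>A path over \<open>v i, ..., v (i + 4)\<close> has four edges, and a zigzag of three
  edges may replace any of them; \<open>k\<close> says which one.\<close>

lemma detourI:
  assumes "2 \<le> p (i + k)" "2 \<le> p (i + k + 7)" "k < 4"
  shows "detour i"
proof -
  have X2: "x \<noteq> y" if "X j x" "X j' y" "j' = j + 2" for j j' x y
    using v2[of j] that by (auto simp: X_def)
  obtain a b c d where z: "X (i + k) a" "X (i + k + 1) b" "X (i + k) c" "X (i + k + 1) d"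
    "adj S a b" "adj S b c" "adj S c d" "a \<noteq> c" "b \<noteq> d"
    using zigzag assms(1,2) by metis
  consider "k = 0" | "k = 1" | "k = 2" | "k = 3" using assms(3) by linarith
  then show ?thesis
  proof cases
    case 1
    then have z': "X i a" "X (i + 1) b" "X i c" "X (i + 1) d"
      using z(1-4) by (simp_all add: numeral_eq_Suc)
    obtain u4 where u4: "adj S d u4" "X (i + 2) u4" using X_up[OF z'(4), of "i + 2"] by auto
    obtain u5 where u5: "adj S u4 u5" "X (i + 3) u5" using X_up[OF u4(2), of "i + 3"] by auto
    obtain y where y: "adj S u5 y" "X (i + 4) y" using X_up[OF u5(2), of "i + 4"] by auto
    have "nbw (adj S) [a, b, c, d, u4, u5, y]"
      using z u4 u5 y 1 X2[OF z'(3) u4(2)] X2[OF z'(4) u5(2)] X2[OF u4(2) y(2)] by (simp add: nbw_Cons)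
    then show ?thesis using z' y u5 by (auto intro: detour_intro)
  next
    case 2
    then have z': "X (i + 1) a" "X (i + 2) b" "X (i + 1) c" "X (i + 2) d"
      using z(1-4) by (simp_all add: numeral_eq_Suc)
    obtain x where x: "adj S x a" "X i x" using X_down[OF z'(1), of i] by auto
    obtain u5 where u5: "adj S d u5" "X (i + 3) u5" using X_up[OF z'(4), of "i + 3"] by auto
    obtain y where y: "adj S u5 y" "X (i + 4) y" using X_up[OF u5(2), of "i + 4"] by auto
    have "nbw (adj S) [x, a, b, c, d, u5, y]"
      using z x u5 y 2 X2[OF x(2) z'(2)] X2[OF z'(3) u5(2)] X2[OF z'(4) y(2)] by (simp add: nbw_Cons)
    then show ?thesis using x z' y u5 by (auto intro: detour_intro)
  next
    case 3
    then have z': "X (i + 2) a" "X (i + 3) b" "X (i + 2) c" "X (i + 3) d"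
      using z(1-4) by (simp_all add: numeral_eq_Suc)
    obtain u1 where u1: "adj S u1 a" "X (i + 1) u1" using X_down[OF z'(1), of "i + 1"] by auto
    obtain x where x: "adj S x u1" "X i x" using X_down[OF u1(2), of i] by auto
    obtain y where y: "adj S d y" "X (i + 4) y" using X_up[OF z'(4), of "i + 4"] by auto
    have "nbw (adj S) [x, u1, a, b, c, d, y]"
      using z x u1 y 3 X2[OF x(2) z'(1)] X2[OF u1(2) z'(2)] X2[OF z'(3) y(2)] by (simp add: nbw_Cons)
    then show ?thesis using x z' y u1 by (auto intro: detour_intro)
  next
    case 4
    then have z': "X (i + 3) a" "X (i + 4) b" "X (i + 3) c" "X (i + 4) d"
      using z(1-4) by (simp_all add: numeral_eq_Suc)
    obtain u2 where u2: "adj S u2 a" "X (i + 2) u2" using X_down[OF z'(1), of "i + 2"] by auto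
    obtain u1 where u1: "adj S u1 u2" "X (i + 1) u1" using X_down[OF u2(2), of "i + 1"] by auto
    obtain x where x: "adj S x u1" "X i x" using X_down[OF u1(2), of i] by auto
    have "nbw (adj S) [x, u1, u2, a, b, c, d]"
      using z x u1 u2 4 X2[OF x(2) u2(2)] X2[OF u1(2) z'(1)] X2[OF u2(2) z'(2)] by (simp add: nbw_Cons)
    then show ?thesis using x z' u1 by (auto intro: detour_intro)
  qed
qed

lemma exists_p_1: "\<exists>i. p i = 1"
proof (rule ccontr)
  assume "\<not> ?thesis"
  then have 2: "2 \<le> p i" for i using p_pos[of i] by (metis Suc_1 Suc_leI le_neq_implies_less)
  have less: "p i < p (i + 4)" for i
    using detour_less'[of i] detourI[of "i + 6" 0] 2 by simp
  show False using less[of 0] less[of 4] less[of 8] p12[of 0] by simp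
qed

text \<open>From \<open>p i = 1\<close> there is no detour at \<open>i + 1\<close>, so on each of
  its four edges \<open>p (i + k + 1)\<close> or \<open>p (i + k + 8)\<close> is 1. By the degree
  condition, once the second alternative holds it holds on all later edges. If the first is used on
  \<open>r\<close> edges and the second on the others, the values 1 fill the indices from
  \<open>i + 8 + r\<close> to \<open>i + 12 + r\<close>, with \<open>p (i + 12) = p i\<close> among
  them.\<close>

lemma five_unique_downs:
  assumes deg: "\<And>i. 3 \<le> p i + p (i + 6)"
  shows "\<exists>m. \<forall>k<5. p (m + k + 7) = 1"
proof -
  obtain i where i: "p i = 1" using exists_p_1 by blast
  have alt: "p (i + k + 1) = 1 \<or> p (i + k + 8) = 1" if "k < 4" for k
  proof (rule ccontr)
    assume not1: "\<not> ?thesis"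
    have e: "i + k + 1 = i + 1 + k" "i + k + 8 = i + 1 + k + 7" by simp_all
    have "2 \<le> p (i + k + 1)" "2 \<le> p (i + k + 8)"
      using p_pos[of "i + k + 1"] p_pos[of "i + k + 8"] not1 by linarith+
    then show False using detourI[of "i + 1" k] no_detour[OF i] that unfolding e by blast
  qed
  have alt': "p (i + 1) = 1 \<or> p (i + 8) = 1" "p (i + 2) = 1 \<or> p (i + 9) = 1"
    "p (i + 3) = 1 \<or> p (i + 10) = 1" "p (i + 4) = 1 \<or> p (i + 11) = 1"
    using alt[of 0] alt[of 1] alt[of 2] alt[of 3] by (simp_all add: numeral_eq_Suc)
  have opp: "p (i + 8) \<noteq> 1 \<or> p (i + 2) \<noteq> 1" "p (i + 9) \<noteq> 1 \<or> p (i + 3) \<noteq> 1"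
      "p (i + 10) \<noteq> 1 \<or> p (i + 4) \<noteq> 1"
    using deg[of "i + 2"] deg[of "i + 3"] deg[of "i + 4"] by (auto simp: numeral_eq_Suc)
  have per: "p (i + 12) = 1" "p (i + 13) = p (i + 1)" "p (i + 14) = p (i + 2)"
      "p (i + 15) = p (i + 3)" "p (i + 16) = p (i + 4)"
    using i p12[of i] p12[of "i + 1"] p12[of "i + 2"] p12[of "i + 3"] p12[of "i + 4"]
    by (simp_all add: numeral_eq_Suc)
  have all5: "?thesis" if "p (m + 7) = 1" "p (m + 8) = 1" "p (m + 9) = 1" "p (m + 10) = 1" "p (m + 11) = 1"
    for m
    using that by (intro exI[of _ m]) (auto simp: eval_nat_numeral less_Suc_eq)
  have s: "?thesis" if "p (i + j + 7) = 1" "p (i + j + 8) = 1" "p (i + j + 9) = 1"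
      "p (i + j + 10) = 1" "p (i + j + 11) = 1" for j
    using that all5[of "i + j"] by (simp add: numeral_eq_Suc)
  \<comment> \<open>One candidate block for each position of the change between the
    alternatives.\<close>
  show ?thesis
    using alt' opp per s[of 1] s[of 2] s[of 3] s[of 4] s[of 5] by (auto simp: numeral_eq_Suc)
qed

lemma climb:
  assumes "X m x" "X (m + 5) z"
  obtains a b c d where "adj S a x" "adj S b a" "adj S c b" "adj S d c" "adj S z d"
    "X (m + 1) a" "X (m + 2) b" "X (m + 3) c" "X (m + 4) d"
proof -
  have "x \<in> elements S" "z \<in> elements S" "f x = v m" "f z = v (m + 5)"
    using assms by (simp_all add: X_def)
  then obtain a b c d where l: "adj S x a" "adj S a b" "adj S b c" "adj S c d" "adj S d z"
      "f a = v (m + 1)" "f b = v (m + 2)" "f c = v (m + 3)" "f d = v (m + 4)"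
    by (rule lift[OF nbw_v6[of m]])
  show ?thesis
    by (rule that[of a b c d]) (use l S.sym S_elements in \<open>unfold X_def, blast+\<close>)
qed

text \<open>By \<open>N_down\<close>, \<open>p (m + k + 7)\<close> counts the neighbours over
  \<open>v (m + k)\<close> of an element over \<open>v (m + k + 1)\<close>. So the descent of five
  steps from a fixed \<open>z\<close> is unique, and lifts from \<open>z\<close> end in both
  \<open>x\<close> and \<open>y\<close>.\<close>

lemma singleton_fibre:
  assumes "\<And>k. k < 5 \<Longrightarrow> p (m + k + 7) = 1" "X m x" "X m y"
  shows "x = y"
proof -
  obtain z where z: "X (m + 5) z" using X_ex by blast
  obtain a b c d where l: "adj S a x" "adj S b a" "adj S c b" "adj S d c" "adj S z d"
      "X (m + 1) a" "X (m + 2) b" "X (m + 3) c" "X (m + 4) d"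
    by (rule climb[OF assms(2) z])
  obtain a' b' c' d' where l': "adj S a' y" "adj S b' a'" "adj S c' b'" "adj S d' c'" "adj S z d'"
      "X (m + 1) a'" "X (m + 2) b'" "X (m + 3) c'" "X (m + 4) d'"
    by (rule climb[OF assms(3) z])
  have u: "w = w'" if "X (m + Suc k) q" "adj S q w" "adj S q w'" "X (m + k) w" "X (m + k) w'" "k < 5" for k w w' q
    using down_unique[of "m + k" q w w'] assms(1)[of k] that by simp
  have "d = d'" using u[of 4 z d d'] l l' z by simp
  then have "c = c'" using u[of 3 d c c'] l l' by simp
  then have "b = b'" using u[of 2 c b b'] l l' by simp
  then have "a = a'" using u[of 1 b a a'] l l' by simp
  then show ?thesis using u[of 0 a x y] l l' assms by simp
qed

lemma degree:
  assumes "{w. adj G (v i) w} = {v (i + 1), v (i + 11)}" "X i x"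
  shows "card {u. adj S x u} = p i + p (i + 6)"
proof -
  let ?A = "{u. adj S x u \<and> f u = v (i + 1)}" and ?B = "{u. adj S x u \<and> f u = v (i + 11)}"
  have un: "{u. adj S x u} = ?A \<union> ?B"
  proof (intro equalityI subsetI)
    fix u assume u: "u \<in> {u. adj S x u}"
    then have "f u \<in> {w. adj G (v i) w}" using f_adj[of x u] assms(2) by (simp add: X_def)
    then show "u \<in> ?A \<union> ?B" unfolding assms(1) using u by auto
  qed auto
  have "v (i + 1) \<noteq> v (i + 11)" using v_neq[of 10 "i + 1"] by (simp add: numeral_eq_Suc)
  then have "?A \<inter> ?B = {}" by auto
  then have "card (?A \<union> ?B) = N x (v (i + 1)) + N x (v (i + 11))"
    unfolding N_def by (rule card_Un_disjoint[OF fin_N fin_N])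
  moreover have "N x (v (i + 11)) = p (i + 6)"
    using N_down[of "i + 11" x] assms(2) X12[of i] p12[of "i + 6"] by (simp add: numeral_eq_Suc)
  ultimately show ?thesis unfolding un using N_up[OF assms(2)] by simp
qed

section \<open>Images with a third neighbour at the odd vertices of the cycle\<close>

lemma third_nbw:
  assumes w: "adj G (v (i + 1)) w" "w \<noteq> v i" "w \<noteq> v (i + 2)"
  shows "nbw (adj G) [w, v (i+1), v (i+2), v (i+3), v (i+4), v (i+5), v (i+6)]"
    and "nbw (adj G) [w, v (i+1), v i, v (i+11), v (i+10), v (i+9), v (i+8)]"
proof -
  show "nbw (adj G) [w, v (i+1), v (i+2), v (i+3), v (i+4), v (i+5), v (i+6)]"
    using w G.sym nbw_v6[of "i + 1"] by (simp add: nbw_Cons numeral_eq_Suc)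
  have "nbw (adj G) [v (i + 13), v (i + 12), v (i + 11), v (i + 10), v (i + 9), v (i + 8)]"
    using nbw_v6'[of "i + 8"] by (simp add: numeral_eq_Suc)
  then show "nbw (adj G) [w, v (i+1), v i, v (i+11), v (i+10), v (i+9), v (i+8)]"
    using w G.sym v12[of i] v12[of "i + 1"] by (simp add: nbw_Cons numeral_eq_Suc)
qed

text \<open>The vertex \<open>w\<close> is opposite to \<open>v (i + 6)\<close> one way round the
  cycle and to \<open>v (i + 8)\<close> the other way, which yields two values for the same
  count.\<close>

lemma third_N:
  assumes w: "adj G (v (i + 1)) w" "w \<noteq> v i" "w \<noteq> v (i + 2)"
    and z: "z \<in> elements S" "f z = w"
  shows "N z (v (i + 1)) = p i" "N z (v (i + 1)) = p (i + 8)"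
proof -
  obtain y where y: "X (i + 6) y" using X_ex by blast
  have "N z (v (i + 1)) = N y (v (i + 5))"
    using N_eq[OF third_nbw(1)[OF w], of z y] z y by (simp add: X_def)
  then show "N z (v (i + 1)) = p i"
    using N_down[of "i + 5" y] y p12[of i] by (simp add: numeral_eq_Suc)
  obtain y' where y': "X (i + 8) y'" using X_ex by blast
  have "N z (v (i + 1)) = N y' (v (i + 9))"
    using N_eq[OF third_nbw(2)[OF w], of z y'] z y' by (simp add: X_def)
  then show "N z (v (i + 1)) = p (i + 8)"
    using N_up[of "i + 8" y'] y' by (simp add: numeral_eq_Suc)
qed

text \<open>The excursion goes through an element over \<open>w\<close> with two neighbours over
  \<open>v (i + 1)\<close>, in place of a zigzag inside the cycle.\<close>

lemma third_detour:
  assumes w: "adj G (v (i + 1)) w" "w \<noteq> v i" "w \<noteq> v (i + 2)" and p: "2 \<le> p i"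
  shows "detour i"
proof -
  obtain c where c: "c \<in> elements S" "f c = w"
    using G_elements(2)[OF w(1)] f_onto by (metis imageE)
  have N2: "2 \<le> N c (v (i + 1))" using third_N[OF w c] p by simp
  obtain b where b: "adj S c b" "f b = v (i + 1)" using N_ge2[OF N2] by blast
  obtain d where d: "adj S c d" "f d = v (i + 1)" "d \<noteq> b" using N_ge2[OF N2] by blast
  have X: "X (Suc i) b" "X (Suc i) d" using b d S_elements by (auto simp: X_def)
  obtain a where a: "adj S a b" "X i a" using X_down[OF X(1), of "i"] by auto
  obtain u4 where u4: "adj S d u4" "X (i + 2) u4" using X_up[OF X(2), of "i + 2"] by auto
  obtain u5 where u5: "adj S u4 u5" "X (i + 3) u5" using X_up[OF u4(2), of "i + 3"] by auto
  obtain y where y: "adj S u5 y" "X (i + 4) y" using X_up[OF u5(2), of "i + 4"] by auto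
  have "nbw (adj S) [a, b, c, d, u4, u5, y]"
    using a b c d u4 u5 y w v2[of "i + 1"] v2[of "i + 2"] S.sym
    by (auto simp: nbw_Cons X_def numeral_eq_Suc)
  then show ?thesis using a X y u5 by (auto intro: detour_intro)
qed

text \<open>On even indices \<open>p\<close> is invariant under shifts by 8, hence by 4, because 16
  is 4 modulo 12. A detour at index 12 or 6 would make two such values differ.\<close>

lemma third_p_1:
  assumes "\<And>k. \<exists>w. adj G (v (2 * k + 1)) w \<and> w \<noteq> v (2 * k) \<and> w \<noteq> v (2 * k + 2)"
  shows "p 0 = 1" "p 6 = 1"
proof -
  have e8: "p (2 * k) = p (2 * k + 8)" for k
  proof -
    obtain w where w: "adj G (v (2 * k + 1)) w" "w \<noteq> v (2 * k)" "w \<noteq> v (2 * k + 2)"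
      using assms by blast
    obtain z where "z \<in> elements S" "f z = w"
      using G_elements(2)[OF w(1)] f_onto by (metis imageE)
    then show ?thesis using third_N[OF w] by metis
  qed
  have e: "p 0 = p 4" "p 6 = p 10"
    using e8[of 0] e8[of 4] e8[of 3] e8[of 7] p12[of 4] p12[of 10] by simp_all
  have d: "detour (2 * k)" if "2 \<le> p (2 * k)" for k
    using assms[of k] third_detour[OF _ _ _ that] by blast
  show "p 0 = 1"
    using d[of 6] detour_less'[of 6] e p12[of 0] p_pos[of 0] by fastforce
  show "p 6 = 1"
    using d[of 3] detour_less'[of 0] e p_pos[of 6] by fastforce
qed

end

section \<open>Recognising class (a)\<close>

lemma join_eq:
  assumes G: "girth12 (adj G)" and ab: "adj G (Inl a) (Inr M)" "adj G (Inr M) (Inl b)" "M \<in> lines G" "a \<noteq> b"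
  shows "join G a b = M" "collinear G a b"
proof -
  interpret girth12 "adj G" by (rule G)
  have uniq: "N = M" if "inc G a N" "inc G b N" for N
  proof -
    have "[Inl a, Inr N, Inl b] = [Inl a, Inr M, Inl b]"
      using ab that by (intro nbw_unique') (auto simp: nbw_Cons)
    then show ?thesis by simp
  qed
  show "join G a b = M" unfolding join_def
  proof (rule the_equality)
    show "M \<in> lines G \<and> inc G a M \<and> inc G b M" using ab by simp
  qed (use uniq in blast)
  show "collinear G a b" using ab by (auto simp: collinear_def)
qed

context hexagon_epi_cycle
begin

lemma v_eqI: "i mod 12 = j mod 12 \<Longrightarrow> v i = v j"
  using cycle_eq_iff[OF v, of i j] by simp

lemma X_eqI: "i mod 12 = j mod 12 \<Longrightarrow> X i = X j"
  using v_eqI[of i j] by (auto simp: X_def)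

lemma nbr:
  assumes r: "elements G = range v" and x: "X i x" "adj S x u"
  shows "X (i + 1) u \<or> X (i + 11) u"
proof -
  have u: "u \<in> elements S" using S_elements x by blast
  then obtain j where j: "f u = v j" using r f_onto by (metis imageE imageI)
  have "chordless (adj G) v" using G.cycle12_chordless[OF v] adj_irrefl by metis
  then have "v j = v (Suc i) \<or> v i = v (Suc j)"
    using f_adj[OF x(2)] x(1) j unfolding chordless_def X_def by metis
  moreover have "v j = v (i + 11)" if "v i = v (Suc j)"
  proof (rule v_eqI)
    have "i mod 12 = Suc j mod 12" using that cycle_eq_iff[OF v, of i "Suc j"] by simp
    then have "(i + 11) mod 12 = (Suc j + 11) mod 12" by (rule mod_add_cong) simp
    then show "j mod 12 = (i + 11) mod 12" by simp
  qed
  ultimately show ?thesis using u j by (auto simp: X_def)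
qed

lemma v_isl: "isl (v i) \<longleftrightarrow> (isl (v 0) \<longleftrightarrow> even i)"
  using cycle_isl[OF v] .

lemma X_isl: "X i x \<Longrightarrow> isl x \<longleftrightarrow> (isl (v 0) \<longleftrightarrow> even i)"
  using v_isl[of i] f_isl[of x] by (simp add: X_def)

text \<open>Edges of the cycle lift at every element, so incidence with a fibre depends on indices
  alone. On \<open>nat\<close>, \<open>i + 11\<close> plays the part of
  \<open>i - 1\<close>.\<close>

lemma inc_iff:
  assumes r: "elements G = range v"
  shows "(\<exists>x. X i (Inl x) \<and> inc S x M) \<longleftrightarrow>
     (isl (v 0) \<longleftrightarrow> even i) \<and> (X (i + 1) (Inr M) \<or> X (i + 11) (Inr M))"
proof
  assume "\<exists>x. X i (Inl x) \<and> inc S x M"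
  then obtain x where x: "X i (Inl x)" "adj S (Inl x) (Inr M)" by auto
  then show "(isl (v 0) \<longleftrightarrow> even i) \<and> (X (i + 1) (Inr M) \<or> X (i + 11) (Inr M))"
    using nbr[OF r x] X_isl[OF x(1)] by simp
next
  assume a: "(isl (v 0) \<longleftrightarrow> even i) \<and> (X (i + 1) (Inr M) \<or> X (i + 11) (Inr M))"
  have "\<exists>u. adj S (Inr M) u \<and> X i u"
  proof (cases "X (i + 1) (Inr M)")
    case True
    then show ?thesis by (rule step_down)
  next
    case False
    then have "\<exists>u. adj S (Inr M) u \<and> X (i + 11 + 1) u" using a step_up[of "i + 11" "Inr M"] by blast
    moreover have "X (i + 11 + 1) = X i" using X12[of i] by (simp only: add.assoc) simp
    ultimately show ?thesis by simp
  qed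
  then obtain u where u: "adj S (Inr M) u" "X i u" by blast
  then show "\<exists>x. X i (Inl x) \<and> inc S x M" by (cases u) auto
qed

lemma collinear_iff:
  assumes r: "elements G = range v" and i: "isl (v 0) \<longleftrightarrow> even i"
  shows "(\<exists>y. X i (Inl y) \<and> collinear S x y) \<longleftrightarrow> X i (Inl x) \<or> X (i + 2) (Inl x) \<or> X (i + 10) (Inl x)"
proof -
  have "(\<exists>y. X i (Inl y) \<and> collinear S x y) \<longleftrightarrow> (\<exists>M. inc S x M \<and> (\<exists>y. X i (Inl y) \<and> inc S y M))"
    using S by (auto simp: collinear_def weak_generalized_polygon_def point_line_geometry_def)
  also have "\<dots> \<longleftrightarrow> (\<exists>M. inc S x M \<and> (X (i + 1) (Inr M) \<or> X (i + 11) (Inr M)))"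
    using inc_iff[OF r, of i] i by simp
  also have "\<dots> \<longleftrightarrow> X i (Inl x) \<or> X (i + 2) (Inl x) \<or> X (i + 10) (Inl x)"
  proof
    assume "\<exists>M. inc S x M \<and> (X (i + 1) (Inr M) \<or> X (i + 11) (Inr M))"
    then obtain M where M: "adj S (Inr M) (Inl x)" "X (i + 1) (Inr M) \<or> X (i + 11) (Inr M)" by auto
    from M(2) show "X i (Inl x) \<or> X (i + 2) (Inl x) \<or> X (i + 10) (Inl x)"
    proof
      assume "X (i + 1) (Inr M)"
      moreover have "X (i + 1 + 11) = X i" "X (i + 1 + 1) = X (i + 2)"
        by (rule X_eqI; simp add: add.assoc)+
      ultimately show ?thesis using nbr[OF r _ M(1), of "i + 1"] by auto
    next
      assume "X (i + 11) (Inr M)"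
      moreover have "X (i + 11 + 11) = X (i + 10)" "X (i + 11 + 1) = X i"
        using X12[of i] X12[of "i + 10"] by (simp_all only: add.assoc) simp_all
      ultimately show ?thesis using nbr[OF r _ M(1), of "i + 11"] by auto
    qed
  next
    assume a: "X i (Inl x) \<or> X (i + 2) (Inl x) \<or> X (i + 10) (Inl x)"
    have "\<exists>u. adj S (Inl x) u \<and> (X (i + 1) u \<or> X (i + 11) u)"
    proof -
      have "X (i + 10 + 1) = X (i + 11)" "X (i + 2) = X (i + 1 + 1)" by (simp_all only: add.assoc) simp_all
      then show ?thesis
        using a step_up[of i "Inl x"] step_down[of "i + 1" "Inl x"] step_up[of "i + 10" "Inl x"] by auto
    qed
    then obtain u where u: "adj S (Inl x) u" "X (i + 1) u \<or> X (i + 11) u" by blast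
    then show "\<exists>M. inc S x M \<and> (X (i + 1) (Inr M) \<or> X (i + 11) (Inr M))" by (cases u) auto
  qed
  finally show ?thesis .
qed

lemma X_disj: "X i x \<Longrightarrow> X j x \<Longrightarrow> i mod 12 = j mod 12"
  using cycle_eq_iff[OF v, of i j] by (simp add: X_def)

text \<open>Counting along the cycle from the line below \<open>L\<close>, the points c, d, e, f, a,
  b sit at 1, 3, 5, 7, 9, 11 and their joins at the even indices. Every set of the definition then
  turns into a condition on indices.\<close>

lemma class_aI:
  assumes f: "f = map_sum (fst \<Phi>) (snd \<Phi>)" and r: "elements G = range v"
    and v0: "\<not> isl (v 0)" and L: "\<And>z. X 0 z \<longleftrightarrow> z = Inr L"
    and s: "card {x \<in> points S. inc S x L} = s + 1"
  shows "class_a S s G \<Phi>"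
proof -
  have isl: "isl (v i) \<longleftrightarrow> odd i" for i using v_isl[of i] v0 by simp
  define P where "P i = projl (v i)" for i
  define Q where "Q i = projr (v i)" for i
  have vP: "v i = Inl (P i)" if "odd i" for i
    using isl[of i] that sum.collapse(1)[of "v i"] by (simp add: P_def)
  have vQ: "v i = Inr (Q i)" if "even i" for i
    using isl[of i] that sum.collapse(2)[of "v i"] by (simp add: Q_def)
  have Qin: "Q i \<in> lines G" if "even i" for i
    using vQ[OF that] G_elements(1)[OF v_adj[of i]] by (auto simp: elements_def)
  have PP: "P i \<noteq> P j" if "odd i" "odd j" "i mod 12 \<noteq> j mod 12" for i j
    using vP[OF that(1)] vP[OF that(2)] cycle_eq_iff[OF v, of i j] that by auto
  have fI: "f (Inl x) = Inl (fst \<Phi> x)" "f (Inr M) = Inr (snd \<Phi> M)" for x M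
    unfolding f by simp_all
  have pf: "x \<in> point_fibre S \<Phi> (P i) \<longleftrightarrow> X i (Inl x)" if "odd i" for i x
    using vP[OF that] by (auto simp: point_fibre_def X_def fI elements_def)
  have lf: "M \<in> line_fibre S \<Phi> (Q i) \<longleftrightarrow> X i (Inr M)" if "even i" for i M
    using vQ[OF that] by (auto simp: line_fibre_def X_def fI elements_def)
  have jn: "join G (P i) (P (i + 2)) = Q (i + 1)" "collinear G (P i) (P (i + 2))"
      "join G (P (i + 2)) (P i) = Q (i + 1)" if "odd i" for i
  proof -
    have e: "adj G (Inl (P i)) (Inr (Q (i + 1)))" "adj G (Inr (Q (i + 1))) (Inl (P (i + 2)))"
      using v_adj[of i] v_adj[of "i + 1"] vP[of i] vQ[of "i + 1"] vP[of "i + 2"] that by simp_all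
    have n: "P i \<noteq> P (i + 2)" using v2[of i] vP[of i] vP[of "i + 2"] that by auto
    show "join G (P i) (P (i + 2)) = Q (i + 1)" "collinear G (P i) (P (i + 2))"
      using join_eq[OF G.girth12_axioms e _ n] Qin[of "i + 1"] that by simp_all
    show "join G (P (i + 2)) (P i) = Q (i + 1)"
      using join_eq(1)[OF G.girth12_axioms, of "P (i + 2)" "Q (i + 1)" "P i"] e n Qin[of "i + 1"] that by simp
  qed
  have P13: "P 13 = P 1" and Q12: "Q 12 = Q 0"
    using v_eqI[of 13 1] v_eqI[of 12 0] by (simp_all add: P_def Q_def)
  have J1: "join G (P 1) (P 3) = Q 2" "collinear G (P 1) (P 3)"
    using jn[of 1] by (simp_all add: numeral_eq_Suc)
  have J11: "join G (P 11) (P 1) = Q 0" "collinear G (P 11) (P 1)"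
    using jn[of 11] P13 Q12 by simp_all
  note J = J1 J11 jn[of 3, simplified] jn[of 5, simplified] jn[of 7, simplified] jn[of 9, simplified]
  have pG: "points G = {P 9, P 11, P 1, P 3, P 5, P 7}"
  proof (intro equalityI subsetI)
    fix q assume "q \<in> points G"
    then have "Inl q \<in> v ` {..<12}" using r cycle_image[OF v] by (auto simp: elements_def)
    then obtain i where i: "i < 12" "v i = Inl q" by force
    then have "odd i" "P i = q" using isl[of i] by (auto simp: P_def)
    moreover from this(1) have "i \<in> {1, 3, 5, 7, 9, 11}" using i(1) by (simp; presburger)
    ultimately show "q \<in> {P 9, P 11, P 1, P 3, P 5, P 7}" by blast
  next
    have "P i \<in> points G" if "odd i" for i
      using vP[OF that] G_elements(1)[OF v_adj[of i]] by (auto simp: elements_def)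
    then show "q \<in> points G" if "q \<in> {P 9, P 11, P 1, P 3, P 5, P 7}" for q using that by auto
  qed
  have dist: "distinct [P 9, P 11, P 1, P 3, P 5, P 7]" using PP by auto
  have Xm: "X 13 = X 1" "X 21 = X 9" "X 19 = X 7" "X 12 = X 0" "X 22 = X 10" "X 14 = X 2"
      "X 20 = X 8" "X 18 = X 6" "X 16 = X 4" "X 15 = X 3" "X 17 = X 5"
    by (rule X_eqI; simp)+
  have col: "(\<exists>y. X i (Inl y) \<and> collinear S x y) \<longleftrightarrow> X i (Inl x) \<or> X j (Inl x) \<or> X k (Inl x)"
    if "odd i" "(i + 2) mod 12 = j mod 12" "(i + 10) mod 12 = k mod 12" for i j k x
    using collinear_iff[OF r, of i x] that v0 X_eqI[OF that(2)] X_eqI[OF that(3)] by simp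
  have incl: "(\<exists>x. X i (Inl x) \<and> inc S x M) \<longleftrightarrow> X j (Inr M) \<or> X k (Inr M)"
    if "odd i" "(i + 1) mod 12 = j mod 12" "(i + 11) mod 12 = k mod 12" for i j k M
    using inc_iff[OF r, of i M] that v0 X_eqI[OF that(2)] X_eqI[OF that(3)] by simp
  have col': "(\<exists>y. X 1 (Inl y) \<and> collinear S x y) \<longleftrightarrow> X 1 (Inl x) \<or> X 3 (Inl x) \<or> X 11 (Inl x)"
    "(\<exists>y. X 3 (Inl y) \<and> collinear S x y) \<longleftrightarrow> X 3 (Inl x) \<or> X 5 (Inl x) \<or> X 1 (Inl x)"
    "(\<exists>y. X 9 (Inl y) \<and> collinear S x y) \<longleftrightarrow> X 9 (Inl x) \<or> X 11 (Inl x) \<or> X 7 (Inl x)"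
    "(\<exists>y. X 11 (Inl y) \<and> collinear S x y) \<longleftrightarrow> X 11 (Inl x) \<or> X 1 (Inl x) \<or> X 9 (Inl x)" for x
    by (rule col; simp)+
  have inc': "(\<exists>x. X 1 (Inl x) \<and> inc S x M) \<longleftrightarrow> X 2 (Inr M) \<or> X 0 (Inr M)"
    "(\<exists>x. X 3 (Inl x) \<and> inc S x M) \<longleftrightarrow> X 4 (Inr M) \<or> X 2 (Inr M)"
    "(\<exists>x. X 5 (Inl x) \<and> inc S x M) \<longleftrightarrow> X 6 (Inr M) \<or> X 4 (Inr M)"
    "(\<exists>x. X 7 (Inl x) \<and> inc S x M) \<longleftrightarrow> X 8 (Inr M) \<or> X 6 (Inr M)"
    "(\<exists>x. X 9 (Inl x) \<and> inc S x M) \<longleftrightarrow> X 10 (Inr M) \<or> X 8 (Inr M)"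
    "(\<exists>x. X 11 (Inl x) \<and> inc S x M) \<longleftrightarrow> X 0 (Inr M) \<or> X 10 (Inr M)" for M
    by (rule incl; simp)+
  have disj: "X i x \<Longrightarrow> X j x \<Longrightarrow> i < 12 \<Longrightarrow> j < 12 \<Longrightarrow> i = j" for i j x
    using X_disj[of i x j] by simp
  have onL: "inc S x L \<longleftrightarrow> X 1 (Inl x) \<or> X 11 (Inl x)" for x
  proof -
    have X0: "X 0 (Inr L)" using L by simp
    have "adj S (Inr L) (Inl x) \<longleftrightarrow> X 1 (Inl x) \<or> X 11 (Inl x)"
    proof
      show "adj S (Inr L) (Inl x) \<Longrightarrow> X 1 (Inl x) \<or> X 11 (Inl x)"
        using nbr[OF r X0] by simp
      assume "X 1 (Inl x) \<or> X 11 (Inl x)"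
      then have "\<exists>u. adj S (Inl x) u \<and> X 0 u"
        using step_down[of 0 "Inl x"] step_up[of 11 "Inl x"] Xm by auto
      then show "adj S (Inr L) (Inl x)" using L by auto
    qed
    then show ?thesis by simp
  qed
  have ptS: "X i (Inl x) \<Longrightarrow> x \<in> points S" and lnS: "X i (Inr M) \<Longrightarrow> M \<in> lines S" for i x M
    by (auto simp: X_def elements_def)
  let ?C = "point_fibre S \<Phi> (P 1)" and ?B = "point_fibre S \<Phi> (P 11)"
  have CB: "?C \<union> ?B = {x \<in> points S. inc S x L}" using pf ptS onL by auto
  have CB': "?C \<inter> ?B = {}" using pf disj[of 1 _ 11] by auto
  have fin': "finite (?C \<union> ?B)" unfolding CB by (rule card_ge_0_finite) (simp add: s)
  have ne: "?C \<noteq> {}" "?B \<noteq> {}"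
  proof -
    have "\<exists>x. X i (Inl x)" if "odd i" for i
    proof -
      obtain z where z: "X i z" using X_ex by blast
      then show ?thesis using X_isl[OF z] v0 that by (cases z) auto
    qed
    from this[of 1] this[of 11] show "?C \<noteq> {}" "?B \<noteq> {}" using pf[of 1] pf[of 11] by auto
  qed
  have "card ?C + card ?B = s + 1"
    using card_Un_disjoint[of ?C ?B] fin' CB' CB s by simp
  moreover have "1 \<le> card ?C" "1 \<le> card ?B"
    using ne fin' by (simp_all add: Suc_le_eq card_gt_0_iff)
  ultimately have cards: "1 \<le> card ?C" "card ?C \<le> s" "1 \<le> card ?B" "card ?B \<le> s" by linarith+
  have LS: "L \<in> lines S" using L[of "Inr L"] lnS by simp
  have LX: "M = L \<longleftrightarrow> X 0 (Inr M)" for M using L by auto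
  have D: "point_fibre S \<Phi> (P 3) = {x \<in> points S. \<not> inc S x L \<and> (\<exists>y\<in>?C. collinear S x y)}"
    using disj[of 3 _ 1] disj[of 3 _ 11] ptS[of 3]
    by (intro set_eqI) (auto simp: pf Bex_def col' onL simp del: One_nat_def)
  have A: "point_fibre S \<Phi> (P 9) = {x \<in> points S. \<not> inc S x L \<and> (\<exists>y\<in>?B. collinear S x y)}"
    using disj[of 9 _ 1] disj[of 9 _ 11] ptS[of 9]
    by (intro set_eqI) (auto simp: pf Bex_def col' onL simp del: One_nat_def)
  have E: "point_fibre S \<Phi> (P 5) = {x \<in> points S. x \<notin> ?C \<union> point_fibre S \<Phi> (P 3) \<and>
      (\<exists>y\<in>point_fibre S \<Phi> (P 3). collinear S x y)}"
    using disj[of 5 _ 1] disj[of 5 _ 3] ptS[of 5]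
    by (intro set_eqI) (auto simp: pf Bex_def col' simp del: One_nat_def)
  have F: "point_fibre S \<Phi> (P 7) = {x \<in> points S. x \<notin> point_fibre S \<Phi> (P 9) \<union> ?B \<and>
      (\<exists>y\<in>point_fibre S \<Phi> (P 9). collinear S x y)}"
    using disj[of 7 _ 11] disj[of 7 _ 9] ptS[of 7]
    by (intro set_eqI) (auto simp: pf Bex_def col' simp del: One_nat_def)
  have BC: "line_fibre S \<Phi> (Q 0) = {L}"
    using L by (intro set_eqI) (auto simp: lf)
  have CD: "line_fibre S \<Phi> (Q 2) = {M \<in> lines S. M \<noteq> L \<and> (\<exists>x\<in>?C. inc S x M)}"
    using disj[of 2 _ 0] lnS[of 2] by (intro set_eqI) (auto simp: lf pf Bex_def inc' LX simp del: One_nat_def)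
  have AB: "line_fibre S \<Phi> (Q 10) = {M \<in> lines S. M \<noteq> L \<and> (\<exists>x\<in>?B. inc S x M)}"
    using disj[of 10 _ 0] lnS[of 10] by (intro set_eqI) (auto simp: lf pf Bex_def inc' LX simp del: One_nat_def)
  have DE: "line_fibre S \<Phi> (Q 4) = {M \<in> lines S. M \<notin> line_fibre S \<Phi> (Q 2) \<and>
      (\<exists>x\<in>point_fibre S \<Phi> (P 3). inc S x M)}"
    using disj[of 4 _ 2] lnS[of 4] by (intro set_eqI) (auto simp: lf pf Bex_def inc' simp del: One_nat_def)
  have FA: "line_fibre S \<Phi> (Q 8) = {M \<in> lines S. M \<notin> line_fibre S \<Phi> (Q 10) \<and>
      (\<exists>x\<in>point_fibre S \<Phi> (P 9). inc S x M)}"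
    using disj[of 8 _ 10] lnS[of 8] by (intro set_eqI) (auto simp: lf pf Bex_def inc' simp del: One_nat_def)
  have FE: "line_fibre S \<Phi> (Q 6) = {M \<in> lines S. M \<notin> line_fibre S \<Phi> (Q 8) \<and>
      (\<exists>x\<in>point_fibre S \<Phi> (P 7). inc S x M)}"
    using disj[of 6 _ 8] lnS[of 6] by (intro set_eqI) (auto simp: lf pf Bex_def inc' simp del: One_nat_def)
  have FE': "line_fibre S \<Phi> (Q 6) = {M \<in> lines S. M \<notin> line_fibre S \<Phi> (Q 4) \<and>
      (\<exists>x\<in>point_fibre S \<Phi> (P 5). inc S x M)}"
    using disj[of 6 _ 4] lnS[of 6] by (intro set_eqI) (auto simp: lf pf Bex_def inc' simp del: One_nat_def)
  show ?thesis
    unfolding class_a_def Let_def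
    by (rule exI[of _ "P 9"], rule exI[of _ "P 11"], rule exI[of _ "P 1"], rule exI[of _ "P 3"],
        rule exI[of _ "P 5"], rule exI[of _ "P 7"], unfold J, rule conjI[OF dist], rule conjI[OF pG],
        intro conjI J bexI[OF _ LS] CB CB' cards D A E F BC CD AB DE FA FE FE')
qed

end

section \<open>Classification\<close>

lemma adj_Inl: "{w. adj G (Inl x) w} = Inr ` {M. inc G x M}"
  by (rule set_eqI; rename_tac w; case_tac w) auto

lemma adj_Inr: "{w. adj G (Inr M) w} = Inl ` {x. inc G x M}"
  by (rule set_eqI; rename_tac w; case_tac w) auto

lemma has_order_card:
  assumes "point_line_geometry G" "has_order G u w"
  shows "x \<in> points G \<Longrightarrow> card {z. adj G (Inl x) z} = w + 1"
    and "M \<in> lines G \<Longrightarrow> card {z. adj G (Inr M) z} = u + 1"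
proof -
  have "{M \<in> lines G. inc G x M} = {M. inc G x M}" "{x \<in> points G. inc G x M} = {x. inc G x M}" for x M
    using assms(1) by (auto simp: point_line_geometry_def)
  then show "x \<in> points G \<Longrightarrow> card {z. adj G (Inl x) z} = w + 1"
    "M \<in> lines G \<Longrightarrow> card {z. adj G (Inr M) z} = u + 1"
    using assms(2) unfolding adj_Inl adj_Inr has_order_def by (simp_all add: card_image)
qed

lemma thick_order:
  assumes "thick S" "has_order S s t" "finite_geometry S" "point_line_geometry S"
  shows "2 \<le> s" "2 \<le> t"
proof -
  obtain x M where x: "x \<in> points S" "M \<in> lines S"
    using assms(4) by (auto simp: point_line_geometry_def)
  have f: "finite {M \<in> lines S. inc S x M}" "finite {x \<in> points S. inc S x M}"
    using assms(3) by (simp_all add: finite_geometry_def)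
  have "3 \<le> card {M \<in> lines S. inc S x M}" "3 \<le> card {x \<in> points S. inc S x M}"
    using assms(1) x card_mono[OF f(1)] card_mono[OF f(2)] unfolding thick_def by metis+
  then show "2 \<le> s" "2 \<le> t" using assms(2) x by (auto simp: has_order_def)
qed

lemma hexagon_epiI:
  assumes "weak_generalized_polygon 6 S" "weak_generalized_polygon 6 G" "finite_geometry S"
    "epimorphism S G \<Phi>"
  shows "hexagon_epi S G (map_sum (fst \<Phi>) (snd \<Phi>))"
proof
  have plg: "point_line_geometry S" using assms(1) by (simp add: weak_generalized_polygon_def)
  show "adj G (map_sum (fst \<Phi>) (snd \<Phi>) x) (map_sum (fst \<Phi>) (snd \<Phi>) y)" if "adj S x y" for x y
    using that plg assms(4) by (cases x; cases y)
      (auto simp: epimorphism_def morphism_def point_line_geometry_def)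
  show "map_sum (fst \<Phi>) (snd \<Phi>) ` elements S = elements G"
    using assms(4) unfolding epimorphism_def elements_def Plus_def by (auto simp: image_Un image_image)
  show "finite {y. adj S x y}" for x
  proof (rule finite_subset)
    show "{y. adj S x y} \<subseteq> elements S" using adj_elements[OF plg] by auto
    show "finite (elements S)" using assms(3) by (simp add: elements_def finite_geometry_def)
  qed
  show "isl (map_sum (fst \<Phi>) (snd \<Phi>) x) = isl x" for x by (cases x) auto
qed (use assms in auto)

text \<open>Used for a given epimorphism, for the folding constructed later, and through the dual
  for class (b).\<close>

lemma class_a_of_singleton_fibre:
  assumes "weak_generalized_polygon 6 S" "weak_generalized_polygon 6 G" "finite_geometry S"
    "epimorphism S G \<Phi>" "has_order S s t"
    and vc: "cycle (adj G) 12 v" "elements G = range v" "\<not> isl (v 0)"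
    and z: "z \<in> elements S" "\<And>x. x \<in> elements S \<Longrightarrow> map_sum (fst \<Phi>) (snd \<Phi>) x = v 0 \<longleftrightarrow> x = z"
  shows "class_a S s G \<Phi>"
proof -
  interpret hexagon_epi S G "map_sum (fst \<Phi>) (snd \<Phi>)"
    using hexagon_epiI assms(1-4) by blast
  interpret hexagon_epi_cycle S G "map_sum (fst \<Phi>) (snd \<Phi>)" v
    by unfold_locales (rule vc)
  have "map_sum (fst \<Phi>) (snd \<Phi>) z = v 0" using z by blast
  then have "\<not> isl z" using vc(3) f_isl[of z] by simp
  then obtain L where L: "z = Inr L" by (cases z) auto
  show ?thesis
  proof (rule class_aI)
    show "X 0 x \<longleftrightarrow> x = Inr L" for x using z L by (auto simp: X_def)
    show "card {x \<in> points S. inc S x L} = s + 1"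
      using assms(5) z L by (auto simp: has_order_def elements_def)
  qed (use vc in auto)
qed

section \<open>Duality as exchange of the two summands\<close>

definition swap_el :: "'a + 'b \<Rightarrow> 'b + 'a" where
  "swap_el = case_sum Inr Inl"

lemma swap_el_simps [simp]: "swap_el (Inl x) = Inr x" "swap_el (Inr y) = Inl y"
  "swap_el (swap_el z) = z" "isl (swap_el z) \<longleftrightarrow> \<not> isl z"
  by (simp_all add: swap_el_def split: sum.splits)

lemma swap_el_eq [simp]: "swap_el x = swap_el y \<longleftrightarrow> x = y"
  by (metis swap_el_simps(3))

lemma nb_map_swap_el: "nb (map swap_el xs) \<longleftrightarrow> nb xs"
  by (induction xs rule: nb.induct) auto

lemma dual_dual [simp]: "dual (dual G) = G" "dual_map (dual_map \<Phi>) = \<Phi>"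
  by (simp_all add: dual_def dual_map_def)

lemma adj_dual [simp]: "adj (dual G) x y \<longleftrightarrow> adj G (swap_el x) (swap_el y)"
  by (cases x; cases y) (auto simp: dual_def)

lemma elements_dual: "elements (dual G) = swap_el ` elements G"
  unfolding elements_def Plus_def by (simp add: dual_def image_Un image_image Un_commute)

lemma cycle_dual: "cycle (adj (dual G)) n (swap_el \<circ> c) \<longleftrightarrow> cycle (adj G) n c"
  by (auto simp: cycle_def inj_on_def)

text \<open>The detour through girth and 12-cycles pays off because both are symmetric in points and
  lines, unlike the numbering of an ordinary polygon.\<close>

lemma dual_weak_hexagon:
  assumes "weak_generalized_polygon 6 G" shows "weak_generalized_polygon 6 (dual G)"
proof (rule weak_hexagonI)
  show "point_line_geometry (dual G)"
    using assms by (auto simp: weak_generalized_polygon_def point_line_geometry_def dual_def)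
  interpret girth12 "adj G" by (rule weak_hexagon_girth12[OF assms])
  show "girth12 (adj (dual G))"
  proof unfold_locales
    fix xs assume xs: "nbw (adj (dual G)) xs" "length xs \<le> 12"
    have "nbw (adj G) (map swap_el xs)"
      using xs(1) by (simp add: nbw_def successively_map nb_map_swap_el)
    then have "distinct (map swap_el xs)" using xs(2) by (intro girth) auto
    then show "distinct xs" by (simp add: distinct_map)
  qed (use sym in auto)
  fix x y assume "x \<in> elements (dual G)" "y \<in> elements (dual G)"
  then obtain x' y' where xy: "x = swap_el x'" "y = swap_el y'" "x' \<in> elements G" "y' \<in> elements G"
    by (auto simp: elements_dual)
  then obtain c where c: "cycle (adj G) 12 c" "c 0 = x'" "y' \<in> range c"
    using weak_hexagon_apartment[OF assms] by metis
  then show "\<exists>c. cycle (adj (dual G)) 12 c \<and> x \<in> range c \<and> y \<in> range c"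
    using cycle_dual[of G 12 c] xy by (intro exI[of _ "swap_el \<circ> c"]) auto
qed

lemma dual_epimorphism: "epimorphism S G \<Phi> \<Longrightarrow> epimorphism (dual S) (dual G) (dual_map \<Phi>)"
  by (auto simp: epimorphism_def morphism_def dual_def dual_map_def)

lemma has_order_dual: "has_order G u w \<Longrightarrow> has_order (dual G) w u"
  by (auto simp: has_order_def dual_def)

text \<open>All degrees are 2, so both neighbours of a vertex of the cycle are on the cycle, and any
  other 12-cycle through \<open>c 0\<close> stays inside it.\<close>

lemma thin_range:
  assumes G: "weak_generalized_polygon 6 G" "has_order G 1 1" and c: "cycle (adj G) 12 c"
  shows "elements G = range c"
proof -
  have plg: "point_line_geometry G" using G(1) by (simp add: weak_generalized_polygon_def)
  have el: "c i \<in> elements G" for i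
    using adj_elements[OF plg, of "c i" "c (Suc i)"] c unfolding cycle_def by blast
  have deg: "card {z. adj G y z} = 2" if "y \<in> elements G" for y
    using has_order_card[OF plg G(2)] that by (cases y) (auto simp: elements_def)
  have step: "z \<in> range c" if "adj G (c i) z" for i z
  proof -
    have c11: "adj G (c i) (c (i + 11))"
    proof -
      have "adj G (c (i + 11)) (c (Suc (i + 11)))" "c (i + 12) = c i"
        using c unfolding cycle_def by blast+
      moreover have e: "Suc (i + 11) = i + 12" by simp
      ultimately show ?thesis unfolding e by (metis adj_sym)
    qed
    have c1: "adj G (c i) (c (Suc i))" using c unfolding cycle_def by blast
    have "c (Suc i) \<noteq> c (i + 11)"
    proof
      assume "c (Suc i) = c (i + 11)"
      then have "(i + 11) mod 12 = Suc i mod 12" using cycle_eq_iff[OF c] by simp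
      then have "12 dvd (10::nat)" using mod_eq_dvd_iff_nat[of "Suc i" "i + 11" 12] by simp
      then show False by (simp add: dvd_def) presburger
    qed
    then have "card {c (Suc i), c (i + 11)} = 2" by simp
    moreover have "finite {z. adj G (c i) z}" using deg[OF el[of i]] by (intro card_ge_0_finite) simp
    ultimately have "{c (Suc i), c (i + 11)} = {z. adj G (c i) z}"
      using c1 c11 deg[OF el[of i]] by (intro card_subset_eq) auto
    then show ?thesis using that by blast
  qed
  have "y \<in> range c" if y: "y \<in> elements G" for y
  proof -
    obtain d where d: "cycle (adj G) 12 d" "d 0 = c 0" "y \<in> range d"
      using weak_hexagon_apartment[OF G(1) el[of 0] y] by blast
    have "d i \<in> range c" for i
    proof (induction i)
      case (Suc i)
      have "adj G (d i) (d (Suc i))" using d(1) unfolding cycle_def by blast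
      then show ?case using Suc step by (metis imageE)
    qed (use d in simp)
    then show ?thesis using d(3) by blast
  qed
  then show ?thesis using el by blast
qed

theorem epimorphism_classification:
  assumes fS: "finite_geometry S" "thick_generalized_hexagon S s t"
    and tG: "thin_generalized_hexagon G s'" and epi: "epimorphism S G \<Phi>"
  shows "s' = 1 \<and> (class_a S s G \<Phi> \<or> class_b S t G \<Phi>)"
proof -
  let ?f = "map_sum (fst \<Phi>) (snd \<Phi>)"
  have S': "weak_generalized_polygon 6 S" "thick S" "has_order S s t"
    using fS(2) by (auto simp: thick_generalized_hexagon_def)
  have G': "weak_generalized_polygon 6 G" "has_order G s' 1" "1 \<le> s'"
    using tG by (auto simp: thin_generalized_hexagon_def)
  have plgS: "point_line_geometry S" and plgG: "point_line_geometry G"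
    using S' G' by (auto simp: weak_generalized_polygon_def)
  note st = thick_order[OF S'(2,3) fS(1) plgS]
  interpret hexagon_epi S G ?f
    using hexagon_epiI S' G' fS(1) epi by blast
  obtain q where "q \<in> points G" using plgG by (auto simp: point_line_geometry_def)
  then have "Inl q \<in> elements G" by (auto simp: elements_def)
  then obtain v where vc: "cycle (adj G) 12 v" "v 0 = Inl q"
    using weak_hexagon_apartment[OF G'(1)] by blast
  interpret hexagon_epi_cycle S G ?f v by unfold_locales (rule vc)
  have isl: "isl (v i) \<longleftrightarrow> even i" for i using v_isl[of i] vc(2) by simp
  have vel: "v i \<in> elements G" for i using G_elements(1)[OF v_adj] .
  have cardG: "card {w. adj G (v i) w} = (if even i then 2 else s' + 1)" for i
    using has_order_card[OF plgG G'(2)] vel[of i] isl[of i] by (cases "v i") (auto simp: elements_def)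
  have two: "v (i + 1) \<noteq> v (i + 11)" "adj G (v i) (v (i + 1))" "adj G (v i) (v (i + 11))" for i
  proof -
    show "v (i + 1) \<noteq> v (i + 11)" using v_neq[of 10 "i + 1"] by (simp add: numeral_eq_Suc)
    show "adj G (v i) (v (i + 1))" using v_adj[of i] by simp
    have "adj G (v (i + 11)) (v (i + 12))" using v_adj[of "i + 11"] by (simp add: numeral_eq_Suc)
    then show "adj G (v i) (v (i + 11))" using adj_sym by simp
  qed
  have nbrs: "{w. adj G (v i) w} = {v (i + 1), v (i + 11)}" if "card {w. adj G (v i) w} = 2" for i
  proof -
    have "finite {w. adj G (v i) w}" using that by (intro card_ge_0_finite) simp
    then have "{v (i + 1), v (i + 11)} = {w. adj G (v i) w}"
      using two[of i] that by (intro card_subset_eq) auto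
    then show ?thesis by simp
  qed
  have deg: "p i + p (i + 6) = (if even i then t + 1 else s + 1)" if "card {w. adj G (v i) w} = 2" for i
  proof -
    obtain x where x: "X i x" using X_ex by blast
    have "isl x \<longleftrightarrow> even i" using X_isl[OF x] isl[of 0] by simp
    then have "card {u. adj S x u} = (if even i then t + 1 else s + 1)"
      using has_order_card[OF plgS S'(3)] x by (cases x) (auto simp: elements_def X_def)
    then show ?thesis using degree[OF nbrs[OF that] x] by simp
  qed
  have s': "s' = 1"
  proof (rule ccontr)
    assume "s' \<noteq> 1"
    have "\<exists>w. adj G (v (2 * k + 1)) w \<and> w \<noteq> v (2 * k) \<and> w \<noteq> v (2 * k + 2)" for k
    proof (rule ccontr)
      assume "\<not> ?thesis"
      then have "{w. adj G (v (2 * k + 1)) w} \<subseteq> {v (2 * k), v (2 * k + 2)}" by auto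
      then have "card {w. adj G (v (2 * k + 1)) w} \<le> card {v (2 * k), v (2 * k + 2)}"
        by (intro card_mono) auto
      also have "\<dots> \<le> 2" by (simp add: card_insert_if)
      finally show False using cardG[of "2 * k + 1"] G'(3) \<open>s' \<noteq> 1\<close> by simp
    qed
    then have "p 0 = 1" "p 6 = 1" by (rule third_p_1)+
    \<comment> \<open>\<open>v 0\<close> is a point and lies on two lines whatever \<open>s'\<close>
      is, so the degree formula applies to it.\<close>
    moreover have "p 0 + p 6 = t + 1" using deg[of 0] cardG[of 0] by simp
    ultimately show False using st by simp
  qed
  have "3 \<le> p i + p (i + 6)" for i using deg[of i] cardG[of i] s' st by (cases "even i") auto
  then obtain m where m: "\<And>k. k < 5 \<Longrightarrow> p (m + k + 7) = 1" using five_unique_downs by blast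
  obtain z where z: "X m z" using X_ex by blast
  have uz: "?f x = v m \<longleftrightarrow> x = z" if "x \<in> elements S" for x
  proof
    assume "?f x = v m"
    then have "X m x" using that by (simp add: X_def)
    then show "x = z" using singleton_fibre[of m x z] m z by blast
  qed (use z in \<open>simp add: X_def\<close>)
  \<comment> \<open>The rotation moves the fibre with one element to index 0; the type of
    \<open>v' 0\<close> then decides between the two classes.\<close>
  define v' where "v' i = v (i + m)" for i
  have v': "cycle (adj G) 12 v'" unfolding v'_def by (rule cycle_shift[OF vc(1)]) simp
  have r: "elements G = range v'" using thin_range[OF G'(1) _ v'] G'(2) s' by simp
  have "class_a S s G \<Phi>" if "\<not> isl (v' 0)"
    by (rule class_a_of_singleton_fibre[OF S'(1) G'(1) fS(1) epi S'(3) v' r that, of z])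
      (use uz z in \<open>auto simp: v'_def X_def\<close>)
  moreover have "class_b S t G \<Phi>" if i: "isl (v' 0)"
    unfolding class_b_def
  proof (rule class_a_of_singleton_fibre[of _ _ _ _ s "swap_el \<circ> v'" "swap_el z"])
    show "finite_geometry (dual S)" using fS(1) by (simp add: finite_geometry_def dual_def)
    show "has_order (dual S) t s" by (rule has_order_dual[OF S'(3)])
    show "cycle (adj (dual G)) 12 (swap_el \<circ> v')" using v' by (simp add: cycle_dual)
    show "elements (dual G) = range (swap_el \<circ> v')" unfolding elements_dual r by auto
    show "\<not> isl ((swap_el \<circ> v') 0)" using i by simp
    show "swap_el z \<in> elements (dual S)" using z by (auto simp: elements_dual X_def)
    fix x assume "x \<in> elements (dual S)"
    then obtain x' where x': "x = swap_el x'" "x' \<in> elements S" by (auto simp: elements_dual)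
    have "map_sum (fst (dual_map \<Phi>)) (snd (dual_map \<Phi>)) (swap_el x') = swap_el (?f x')"
      by (cases x') (auto simp: dual_map_def)
    then show "map_sum (fst (dual_map \<Phi>)) (snd (dual_map \<Phi>)) x = (swap_el \<circ> v') 0 \<longleftrightarrow> x = swap_el z"
      using uz[OF x'(2)] x'(1) by (simp add: v'_def)
  qed (rule dual_weak_hexagon dual_epimorphism S'(1) G'(1) epi)+
  ultimately show ?thesis using s' by blast
qed

section \<open>Folding along the distance from a line\<close>

text \<open>The points of \<open>L\<close> are divided into \<open>c\<close> and all others: walks
  leaving \<open>L\<close> through \<open>c\<close> are sent up the cycle from \<open>v 0\<close>,
  the others down from \<open>v 12\<close>.\<close>

locale folding =
  fixes S :: "('p, 'l) geometry" and s t :: nat and G :: "('q, 'm) geometry"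
    and v :: "nat \<Rightarrow> 'q + 'm" and L :: 'l and c :: 'p
  assumes fS: "finite_geometry S" and hS: "weak_generalized_polygon 6 S" and oS: "has_order S s t"
    and s: "1 \<le> s" and t: "1 \<le> t"
    and hG: "weak_generalized_polygon 6 G"
    and v: "cycle (adj G) 12 v" and r: "elements G = range v" and v0: "\<not> isl (v 0)"
    and cL: "inc S c L"
begin

sublocale S: girth12 "adj S" by (rule weak_hexagon_girth12[OF hS])

lemma plg: "point_line_geometry S"
  using hS by (simp add: weak_generalized_polygon_def)

lemma L_el: "Inr L \<in> elements S"
  using adj_elements[OF plg, of "Inl c" "Inr L"] cL by simp

definition track :: "('p + 'l) list \<Rightarrow> 'p + 'l \<Rightarrow> bool" where
  "track ws x \<longleftrightarrow> nbw (adj S) ws \<and> ws \<noteq> [] \<and> hd ws = Inr L \<and> last ws = x \<and> length ws \<le> 7"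

text \<open>A track with \<open>n\<close> edges goes to \<open>v n\<close> or to
  \<open>v (12 - n)\<close>. The trivial track goes to \<open>v 12\<close>, which is
  \<open>v 0\<close>.\<close>

definition fold_track :: "('p + 'l) list \<Rightarrow> 'q + 'm" where
  "fold_track ws = (if 1 < length ws \<and> ws ! 1 = Inl c then v (length ws - 1) else v (13 - length ws))"

definition F :: "'p + 'l \<Rightarrow> 'q + 'm" where
  "F x = fold_track (SOME ws. track ws x)"

text \<open>Shortest walks from \<open>L\<close> are unique except for those ending in a line at distance 6 from
  \<open>L\<close>, and both folding rules send these lines to \<open>v 6\<close>.\<close>

lemma F_eq: assumes "track ws x" shows "F x = fold_track ws"
proof -
  have 2: "track (SOME ws. track ws x) x" using assms by (rule someI)
  show ?thesis
  proof (cases "length ws + length (SOME ws. track ws x) \<le> 13")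
    case True
    then have "(SOME ws. track ws x) = ws"
      using 2 assms by (intro S.nbw_unique') (auto simp: track_def)
    then show ?thesis by (simp add: F_def)
  next
    case False
    then have "length ws = 7" "length (SOME ws. track ws x) = 7" using 2 assms by (auto simp: track_def)
    then show ?thesis by (simp add: F_def fold_track_def)
  qed
qed

lemma v_adj: "adj G (v i) (v (Suc i))"
  using v unfolding cycle_def by blast

lemma v12: "v 12 = v 0"
  using cycle_mod[OF v, of 12] by simp

lemma track_exists: assumes "x \<in> elements S" shows "\<exists>ws. track ws x"
proof -
  obtain d where d: "cycle (adj S) 12 d" "d 0 = Inr L" "x \<in> range d"
    using weak_hexagon_apartment[OF hS L_el assms] by blast
  then obtain j where j: "j < 12" "x = d j" using cycle_image[OF d(1)] by auto
  have n: "nbw (adj S) (map d [i..<k])" for i k using cycle_nbw[OF d(1)] by simp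
  show ?thesis
  proof (cases "j \<le> 6")
    case True
    have "track (map d [0..<Suc j]) x"
      using n[of 0 "Suc j"] True j d(2) unfolding track_def
      by (simp add: hd_map last_map del: upt_Suc)
    then show ?thesis by blast
  next
    case False
    have "d 12 = Inr L" using cycle_mod[OF d(1), of 12] d(2) by simp
    moreover have "hd (map d [j..<13]) = x" using False j by (simp add: hd_map)
    ultimately have "track (rev (map d [j..<13])) x"
      using S.nbw_rev[OF n] False j unfolding track_def
      by (simp add: hd_rev last_rev last_map)
    then show ?thesis by blast
  qed
qed

lemma track_isl: "track ws x \<Longrightarrow> isl x \<longleftrightarrow> even (length ws)"
  using successively_isl[of S "hd ws" "tl ws"] by (cases ws) (auto simp: track_def nbw_def)

lemma v_isl: "isl (v i) \<longleftrightarrow> odd i"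
  using cycle_isl[OF v, of i] v0 by simp

lemma F_isl: assumes "x \<in> elements S" shows "isl (F x) \<longleftrightarrow> isl x"
proof -
  obtain ws where ws: "track ws x" using track_exists[OF assms] by blast
  then have "1 \<le> length ws" "length ws \<le> 7" by (auto simp: track_def Suc_le_eq)
  then show ?thesis
    using F_eq[OF ws] track_isl[OF ws] by (auto simp: fold_track_def v_isl)
qed

lemma fold_track_snoc:
  assumes "ws \<noteq> []" "length ws \<le> 6" shows "adj G (fold_track ws) (fold_track (ws @ [y]))"
proof -
  obtain n where n: "length ws = Suc n" "n < 6" using assms by (cases ws) auto
  have a: "adj G (v n) (v (Suc n))" "adj G (v (12 - n)) (v (12 - Suc n))"
  proof -
    have "Suc (12 - Suc n) = 12 - n" using n(2) by simp
    then show "adj G (v n) (v (Suc n))" "adj G (v (12 - n)) (v (12 - Suc n))"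
      using v_adj[of n] v_adj[of "12 - Suc n"] adj_sym by metis+
  qed
  show ?thesis
  proof (cases n)
    case 0
    then have "fold_track ws = v 12" using n by (simp add: fold_track_def)
    moreover have "fold_track (ws @ [y]) = v 1 \<or> fold_track (ws @ [y]) = v 11"
      using n 0 by (simp add: fold_track_def nth_append)
    ultimately show ?thesis using a 0 v12 by auto
  next
    case (Suc m)
    then have "(ws @ [y]) ! 1 = ws ! 1" using n by (simp add: nth_append)
    then show ?thesis using a n Suc by (simp add: fold_track_def)
  qed
qed

text \<open>Either \<open>y\<close> is the last vertex but one of the track to \<open>x\<close>, or
  appending \<open>y\<close> gives a track to \<open>y\<close>; the bound 6 leaves room for this
  vertex.\<close>

lemma F_adj_aux:
  assumes "adj S x y" "track ws x" "length ws \<le> 6"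
  shows "adj G (F x) (F y)"
proof (cases "\<exists>us. ws = us @ [y, x]")
  case True
  then obtain us where us: "ws = us @ [y, x]" by blast
  then have "track (us @ [y]) y"
    using assms(2) nbw_butlast[of "adj S" "us @ [y]" "[x]"] by (cases us) (auto simp: track_def)
  moreover have "adj G (fold_track (us @ [y])) (fold_track ((us @ [y]) @ [x]))"
    using us assms(3) by (intro fold_track_snoc) auto
  ultimately show ?thesis using F_eq[OF assms(2)] F_eq[of "us @ [y]" y] us adj_sym by auto
next
  case False
  obtain us where us: "ws = us @ [x]"
    using assms(2) by (auto simp: track_def) (metis append_butlast_last_id)
  have "nbw (adj S) (us @ [x, y])"
  proof (rule nbw_snoc)
    show "last us \<noteq> y" if "us \<noteq> []"
    proof
      assume "last us = y"
      then have "ws = butlast us @ [y, x]" using us that by (metis append.assoc append_Cons append_Nil append_butlast_last_id)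
      then show False using False by blast
    qed
  qed (use us assms in \<open>auto simp: track_def\<close>)
  then have "track (ws @ [y]) y" using us assms(2,3) by (cases us) (auto simp: track_def)
  then show ?thesis
    using F_eq[OF assms(2)] F_eq[of "ws @ [y]" y] fold_track_snoc[of ws y] assms(3) us by auto
qed

text \<open>Tracks to adjacent elements have lengths of different parity, so they are not both of
  the maximal length 7.\<close>

lemma F_adj: assumes "adj S x y" shows "adj G (F x) (F y)"
proof -
  have "x \<in> elements S" "y \<in> elements S" using adj_elements[OF plg assms] by auto
  then obtain ws us where ws: "track ws x" "track us y" using track_exists by metis
  have "even (length ws) \<noteq> even (length us)"
    using adj_isl[OF assms] track_isl[OF ws(1)] track_isl[OF ws(2)] by simp
  then have "length ws \<noteq> length us" by metis
  then have "length ws \<le> 6 \<or> length us \<le> 6" using ws by (auto simp: track_def)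
  then show ?thesis
    using F_adj_aux[OF assms ws(1)] F_adj_aux[OF adj_sym[OF assms] ws(2)] adj_sym by blast
qed

lemma F_0: assumes "x \<in> elements S" shows "F x = v 0 \<longleftrightarrow> x = Inr L"
proof -
  obtain ws where ws: "track ws x" using track_exists[OF assms] by blast
  then have l: "1 \<le> length ws" "length ws \<le> 7" by (auto simp: track_def Suc_le_eq)
  have *: "v i = v 0 \<longleftrightarrow> i = 0 \<or> i = 12" if "i \<le> 12" for i
    using cycle_eq_iff[OF v, of i 0] that by (cases "i = 12") auto
  have "F x = v 0 \<longleftrightarrow> length ws = 1"
    using F_eq[OF ws] l by (auto simp: fold_track_def *)
  also have "\<dots> \<longleftrightarrow> x = Inr L"
  proof
    assume "length ws = 1"
    then show "x = Inr L" using ws by (cases ws) (auto simp: track_def)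
  next
    assume x: "x = Inr L"
    have "ws = [Inr L]"
      using ws x l by (intro S.nbw_unique') (auto simp: track_def)
    then show "length ws = 1" by simp
  qed
  finally show ?thesis .
qed

lemma other_neighbour: assumes "x \<in> elements S" shows "\<exists>z. adj S x z \<and> z \<noteq> y"
proof (rule ccontr)
  assume "\<not> ?thesis"
  then have "{z. adj S x z} \<subseteq> {y}" by auto
  then have "card {z. adj S x z} \<le> card {y}" by (intro card_mono) auto
  then show False
    using has_order_card[OF plg oS] assms s t by (cases x) (auto simp: elements_def)
qed

lemma long_track:
  assumes "inc S b L" "n < 6"
  shows "\<exists>ws x. track ws x \<and> x \<in> elements S \<and> length ws = n + 2 \<and> ws ! 1 = Inl b"
  using assms(2)
proof (induction n)
  case 0
  have "adj S (Inr L) (Inl b)" using assms(1) by simp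
  then show ?case using adj_elements[OF plg, of "Inr L" "Inl b"] assms(1)
    by (intro exI[of _ "[Inr L, Inl b]"] exI[of _ "Inl b"]) (auto simp: track_def nbw_Cons)
next
  case (Suc n)
  then obtain ws x where ws: "track ws x" "x \<in> elements S" "length ws = n + 2" "ws ! 1 = Inl b" by auto
  obtain us where us: "ws = us @ [x]"
    using ws(1) by (auto simp: track_def) (metis append_butlast_last_id)
  obtain z where z: "adj S x z" "z \<noteq> last us" using other_neighbour[OF ws(2)] by blast
  have "nbw (adj S) (us @ [x, z])" using ws(1) us z by (intro nbw_snoc) (auto simp: track_def)
  then have "track (ws @ [z]) z" using us ws(1,3) Suc.prems by (cases us) (auto simp: track_def)
  moreover have "(ws @ [z]) ! 1 = Inl b" using ws(3,4) by (simp add: nth_append)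
  moreover have "z \<in> elements S" using adj_elements[OF plg z(1)] by simp
  ultimately show ?case using ws(3) by (intro exI[of _ "ws @ [z]"] exI[of _ z]) auto
qed

text \<open>Vertices up to index 6 are reached by tracks through \<open>c\<close>, the later ones by
  tracks through another point \<open>b\<close> of \<open>L\<close>.\<close>

lemma F_onto: "F ` elements S = elements G"
proof (intro equalityI subsetI)
  fix y assume "y \<in> F ` elements S"
  then obtain x where x: "y = F x" "x \<in> elements S" by blast
  then obtain ws where "track ws x" using track_exists by blast
  then show "y \<in> elements G" using x F_eq r by (auto simp: fold_track_def)
next
  fix y assume "y \<in> elements G"
  then obtain i where i: "i < 12" "y = v i" using r cycle_image[OF v] by auto
  obtain b where b: "inc S b L" "b \<noteq> c"
  proof -
    obtain z where "adj S (Inr L) z" "z \<noteq> Inl c" using other_neighbour[OF L_el] by blast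
    then show ?thesis using that by (cases z) auto
  qed
  consider "i = 0" | "0 < i" "i \<le> 6" | "6 < i" "i < 12" using i by linarith
  then show "y \<in> F ` elements S"
  proof cases
    case 1
    then show ?thesis using F_0[OF L_el] i L_el by (metis imageI)
  next
    case 2
    then have less: "i - 1 < 6" by linarith
    obtain ws x where ws: "track ws x" "x \<in> elements S" "length ws = (i - 1) + 2" "ws ! 1 = Inl c"
      using long_track[OF cL, of "i - 1"] less by blast
    then have "F x = v i" using F_eq[OF ws(1)] 2 by (simp add: fold_track_def)
    then show ?thesis using ws(2) i by (metis imageI)
  next
    case 3
    then have less: "11 - i < 6" by linarith
    obtain ws x where ws: "track ws x" "x \<in> elements S" "length ws = (11 - i) + 2" "ws ! 1 = Inl b"
      using long_track[OF b(1), of "11 - i"] less by blast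
    then have "F x = v i" using F_eq[OF ws(1)] 3 b by (simp add: fold_track_def)
    then show ?thesis using ws(2) i by (metis imageI)
  qed
qed

definition \<Phi> :: "('p, 'l, 'q, 'm) geometry_map" where
  "\<Phi> = (\<lambda>x. projl (F (Inl x)), \<lambda>M. projr (F (Inr M)))"

lemma \<Phi>_eq: "x \<in> elements S \<Longrightarrow> map_sum (fst \<Phi>) (snd \<Phi>) x = F x"
  using F_isl[of x] by (cases x; cases "F x") (auto simp: \<Phi>_def)

lemma F_Inl: "x \<in> points S \<Longrightarrow> F (Inl x) = Inl (fst \<Phi> x)"
  using \<Phi>_eq[of "Inl x"] by (simp add: elements_def InlI)

lemma F_Inr: "M \<in> lines S \<Longrightarrow> F (Inr M) = Inr (snd \<Phi> M)"
  using \<Phi>_eq[of "Inr M"] by (simp add: elements_def InrI)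

lemma epi: "epimorphism S G \<Phi>"
proof -
  have im: "map_sum (fst \<Phi>) (snd \<Phi>) ` elements S = elements G"
    unfolding F_onto[symmetric] by (rule image_cong[OF refl \<Phi>_eq])
  then have "Inl ` fst \<Phi> ` points S \<union> Inr ` snd \<Phi> ` lines S = Inl ` points G \<union> Inr ` lines G"
    by (simp add: elements_def Plus_def image_Un image_image)
  then have "Inl -` (Inl ` fst \<Phi> ` points S \<union> Inr ` snd \<Phi> ` lines S) = Inl -` (Inl ` points G \<union> Inr ` lines G)"
    "Inr -` (Inl ` fst \<Phi> ` points S \<union> Inr ` snd \<Phi> ` lines S) = Inr -` (Inl ` points G \<union> Inr ` lines G)"
    by simp_all
  then have "fst \<Phi> ` points S = points G" "snd \<Phi> ` lines S = lines G"
    by (auto simp: vimage_def set_eq_iff)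
  moreover have "inc G (fst \<Phi> x) (snd \<Phi> M)" if "x \<in> points S" "M \<in> lines S" "inc S x M" for x M
    using F_adj[of "Inl x" "Inr M"] F_Inl F_Inr that by simp
  ultimately show ?thesis by (auto simp: epimorphism_def morphism_def)
qed

lemma class_a_folding: "class_a S s G \<Phi>"
  using class_a_of_singleton_fibre[OF hS hG fS epi oS v r v0 L_el] F_0 \<Phi>_eq by simp

end

lemma exists_class_a:
  assumes "finite_geometry S" "thick_generalized_hexagon S s t" "thin_generalized_hexagon G 1"
  shows "\<exists>\<Phi>. epimorphism S G \<Phi> \<and> class_a S s G \<Phi>"
proof -
  have S: "weak_generalized_polygon 6 S" "thick S" "has_order S s t"
    using assms(2) by (auto simp: thick_generalized_hexagon_def)
  have G: "weak_generalized_polygon 6 G" "has_order G 1 1"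
    using assms(3) by (auto simp: thin_generalized_hexagon_def)
  have plg: "point_line_geometry S" "point_line_geometry G"
    using S(1) G(1) by (auto simp: weak_generalized_polygon_def)
  note st = thick_order[OF S(2,3) assms(1) plg(1)]
  obtain L where L: "L \<in> lines S" using plg(1) by (auto simp: point_line_geometry_def)
  have "card {x \<in> points S. inc S x L} = s + 1" using S(3) L by (simp add: has_order_def)
  then have "{x \<in> points S. inc S x L} \<noteq> {}" by (metis card.empty add_is_0 one_neq_zero)
  then obtain c where c: "inc S c L" by blast
  obtain M where "M \<in> lines G" using plg(2) by (auto simp: point_line_geometry_def)
  then have "Inr M \<in> elements G" by (simp add: elements_def InrI)
  then obtain v where v: "cycle (adj G) 12 v" "v 0 = Inr M"
    using weak_hexagon_apartment[OF G(1)] by blast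
  interpret folding S s t G v L c
    by unfold_locales (use assms S G st c v thin_range[OF G v(1)] in auto)
  show ?thesis using epi class_a_folding by blast
qed

lemma exists_class_b:
  assumes "finite_geometry S" "thick_generalized_hexagon S s t" "thin_generalized_hexagon G 1"
  shows "\<exists>\<Phi>. epimorphism S G \<Phi> \<and> class_b S t G \<Phi>"
proof -
  have "finite_geometry (dual S)" "thick (dual S)" "\<not> thick (dual G)"
    using assms by (auto simp: finite_geometry_def thick_def dual_def thick_generalized_hexagon_def
        thin_generalized_hexagon_def)
  then have "finite_geometry (dual S)" "thick_generalized_hexagon (dual S) t s"
      "thin_generalized_hexagon (dual G) 1"
    using assms dual_weak_hexagon has_order_dual
    unfolding thick_generalized_hexagon_def thin_generalized_hexagon_def by blast+
  then obtain \<Psi> where "epimorphism (dual S) (dual G) \<Psi>" "class_a (dual S) t (dual G) \<Psi>"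
    using exists_class_a by blast
  then show ?thesis
    using dual_epimorphism[of "dual S" "dual G" \<Psi>]
    by (intro exI[of _ "dual_map \<Psi>"]) (simp add: class_b_def)
qed

section \<open>Hexagons from counting walks\<close>

fun ext :: "('v \<Rightarrow> 'v list) \<Rightarrow> 'v list \<Rightarrow> 'v list list" where
  "ext N [] = []"
| "ext N [x] = map (\<lambda>z. [z, x]) (N x)"
| "ext N (x # y # w) = map (\<lambda>z. z # x # y # w) (filter (\<lambda>z. z \<noteq> y) (N x))"

fun walks :: "('v \<Rightarrow> 'v list) \<Rightarrow> 'v \<Rightarrow> nat \<Rightarrow> 'v list list" where
  "walks N x 0 = [[x]]"
| "walks N x (Suc k) = concat (map (ext N) (walks N x k))"

context sym_graph
begin

lemma set_ext:
  assumes "\<And>a b. E a b \<longleftrightarrow> b \<in> set (N a)" "nbw E w" "w \<noteq> []"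
  shows "u \<in> set (ext N w) \<longleftrightarrow> (\<exists>z. u = z # w) \<and> nbw E u"
  using assms sym by (cases "(N, w)" rule: ext.cases) (auto simp: nbw_Cons)

lemma set_walks:
  assumes "\<And>a b. E a b \<longleftrightarrow> b \<in> set (N a)"
  shows "w \<in> set (walks N x k) \<longleftrightarrow> nbw E w \<and> length w = Suc k \<and> last w = x"
proof (induction k arbitrary: w)
  case 0
  then show ?case by (auto simp: length_Suc_conv)
next
  case (Suc k)
  have "u \<in> set (walks N x k) \<and> w \<in> set (ext N u) \<longleftrightarrow>
      nbw E u \<and> length u = Suc k \<and> last u = x \<and> (\<exists>z. w = z # u) \<and> nbw E w" for u
    using Suc.IH[of u] set_ext[OF assms, of u w] by (cases "u = []") auto
  then have "w \<in> set (walks N x (Suc k)) \<longleftrightarrow>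
      (\<exists>u. nbw E u \<and> length u = Suc k \<and> last u = x \<and> (\<exists>z. w = z # u) \<and> nbw E w)"
    by (simp add: Bex_def)
  also have "\<dots> \<longleftrightarrow> nbw E w \<and> length w = Suc (Suc k) \<and> last w = x"
    by (cases w) (auto dest: nbw_ConsD)
  finally show ?case .
qed

end

text \<open>The walks are listed with their end point first.\<close>

definition odd_walks :: "('v \<Rightarrow> 'v list) \<Rightarrow> 'v \<Rightarrow> 'v list list" where
  "odd_walks N x = walks N x 1 @ walks N x 3 @ walks N x 5"

text \<open>The incidence graph attains the Moore bound for girth 12, so girth and diameter both follow from
  counting the walks of odd length at most 5 that start in a point.\<close>

locale moore_hexagon =
  fixes G :: "('p, 'l) geometry" and N :: "'p + 'l \<Rightarrow> ('p + 'l) list"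
  assumes plg: "point_line_geometry G" and fin: "finite (lines G)"
    and N: "adj G a b \<longleftrightarrow> b \<in> set (N a)"
    and dist: "x \<in> points G \<Longrightarrow> distinct (map hd (odd_walks N (Inl x)))"
    and len: "x \<in> points G \<Longrightarrow> card (lines G) \<le> length (odd_walks N (Inl x))"
    and deg: "a \<in> elements G \<Longrightarrow> \<exists>z. adj G a z \<and> z \<noteq> b"
begin

sublocale sg: sym_graph "adj G" by unfold_locales (rule adj_sym)

lemma odd_walks_iff:
  "w \<in> set (odd_walks N x) \<longleftrightarrow> nbw (adj G) w \<and> last w = x \<and> length w \<in> {2, 4, 6}"
  unfolding odd_walks_def set_append Un_iff sg.set_walks[OF N] by auto

lemma walk_unique:
  assumes "x \<in> points G" "nbw (adj G) w" "nbw (adj G) u" "last w = Inl x" "last u = Inl x" "hd w = hd u"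
    "length w \<in> {2, 4, 6}" "length u \<in> {2, 4, 6}"
  shows "w = u"
  using dist[OF assms(1)] assms odd_walks_iff[of w] odd_walks_iff[of u]
  by (auto simp: distinct_map dest: inj_onD)

text \<open>The end points are pairwise distinct lines and at least as numerous as all lines, so no
  line is missed.\<close>

lemma walk_exists:
  assumes "x \<in> points G" "M \<in> lines G"
  shows "\<exists>w. nbw (adj G) w \<and> last w = Inl x \<and> hd w = Inr M \<and> length w \<in> {2, 4, 6}"
proof -
  let ?H = "hd ` set (odd_walks N (Inl x))"
  have "?H \<subseteq> Inr ` lines G"
  proof
    fix z assume "z \<in> ?H"
    then obtain w where w: "nbw (adj G) w" "last w = Inl x" "length w \<in> {2, 4, 6}" "z = hd w"
      using odd_walks_iff by auto
    then obtain y ys where y: "w = z # y # ys" by (cases w; cases "tl w") auto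
    have "successively (adj G) (z # y # ys)" using w(1) unfolding y nbw_def by blast
    moreover have "last (z # y # ys) = Inl x" using w(2) unfolding y .
    moreover have "odd (length (y # ys))" using w(3) y by auto
    ultimately have "\<not> isl z" using successively_isl[of G z "y # ys"] by (auto simp del: last.simps)
    moreover have "z \<in> elements G" using w(1) adj_elements[OF plg, of z y] unfolding y by (simp add: nbw_Cons)
    ultimately show "z \<in> Inr ` lines G" by (auto simp: elements_def)
  qed
  moreover have "card ?H = length (odd_walks N (Inl x))"
    using dist[OF assms(1)] distinct_card by fastforce
  moreover have "card (Inr ` lines G :: ('p + 'l) set) = card (lines G)" by (simp add: card_image)
  ultimately have "?H = Inr ` lines G"
    using len[OF assms(1)] fin by (intro card_seteq) auto
  then have "Inr M \<in> ?H" using assms(2) by simp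
  then show ?thesis using odd_walks_iff by auto
qed

text \<open>Cut the cycle at the point \<open>c 0\<close> into two arcs of odd length at most 5: 4 =
  1 + 3, 6 = 3 + 3, 8 = 3 + 5, 10 = 5 + 5. Both join \<open>c 0\<close> to \<open>c j\<close>, so by
  uniqueness they are the same walk. Then they have equal length, and
  \<open>c (n - 1) = c 1\<close>.\<close>

lemma no_short_cycle_aux:
  assumes c: "cycle (adj G) n c" "3 \<le> n" "n < 12" "isl (c 0)"
  shows False
proof -
  obtain x where x: "c 0 = Inl x" using c(4) by (cases "c 0") auto
  have "adj G (c 0) (c (Suc 0))" using c(1) unfolding cycle_def by blast
  then have xp: "x \<in> points G" using adj_elements[OF plg, of "c 0"] x by (auto simp: elements_def)
  have "even n" using cycle_even[OF c(1)] .
  then have "n \<in> {4, 6, 8, 10}" using c(2,3) by (simp; presburger)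
  then have "\<exists>j. odd j \<and> j \<in> {1, 3, 5} \<and> n - j \<in> {1, 3, 5} \<and> j < n"
  proof (elim insertE emptyE)
    show ?thesis if "n = 4" using that by (intro exI[of _ 1]) simp
    show ?thesis if "n = 6" using that by (intro exI[of _ 3]) simp
    show ?thesis if "n = 8" using that by (intro exI[of _ 3]) simp
    show ?thesis if "n = 10" using that by (intro exI[of _ 5]) simp
  qed
  then obtain j where j: "odd j" "j \<in> {1, 3, 5}" "n - j \<in> {1, 3, 5}" "j < n" by blast
  have n: "nbw (adj G) (map c [i..<k])" for i k using cycle_nbw[OF c(1,2)] .
  have cn: "c n = c 0" using cycle_mod[OF c(1), of n] by simp
  let ?w = "map c [j..<Suc n]" and ?u = "rev (map c [0..<Suc j])"
  have eq: "?w = ?u"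
  proof (rule walk_unique[OF xp n sg.nbw_rev[OF n]])
    show "last ?w = Inl x" using j x cn by (simp add: last_map)
    show "last ?u = Inl x" using x by (simp add: last_rev hd_map del: upt_Suc)
    show "hd ?w = hd ?u" using j by (simp add: hd_rev hd_map last_map del: upt_Suc)
    show "length ?w \<in> {2, 4, 6}" "length ?u \<in> {2, 4, 6}" using j by auto
  qed
  have "length ?w = length ?u" by (rule arg_cong[OF eq])
  then have "n - j = j" using j(4) by (simp only: length_map length_rev length_upt)
  then have l: "n = j + j" using j(4) by simp
  have "?w ! (j - 1) = c (n - 1)" using j l by (simp del: upt_Suc)
  moreover have "?u ! (j - 1) = c 1" using j l by (simp add: rev_nth del: upt_Suc)
  ultimately have "c (n - 1) = c 1" using eq by simp
  then have "(n - 1) mod n = 1 mod n" using cycle_eq_iff[OF c(1)] c(2) by simp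
  then show False using c(2) by simp
qed

lemma no_short_cycle:
  assumes c: "cycle (adj G) n c" "3 \<le> n" "n < 12" shows False
proof (cases "isl (c 0)")
  case False
  have "isl (c (0 + 1))" using cycle_isl[OF c(1), of 1] False by simp
  then show False using no_short_cycle_aux[of n "\<lambda>i. c (i + 1)"] cycle_shift[OF c(1), of 1] c(2,3) by simp
qed (use no_short_cycle_aux c in blast)

sublocale girth12 "adj G"
proof unfold_locales
  fix xs assume "nbw (adj G) xs" "length xs \<le> 12"
  then show "distinct xs"
    using nbw_cycle[of "adj G" xs] no_short_cycle adj_irrefl[of G] by fastforce
qed

lemma odd_walk:
  assumes "x \<in> elements G" "y \<in> elements G" "isl x \<noteq> isl y"
  shows "\<exists>w. nbw (adj G) w \<and> hd w = x \<and> last w = y \<and> 2 \<le> length w \<and> length w \<le> 6"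
proof (cases "isl x")
  case True
  then obtain p M where "x = Inl p" "y = Inr M" "p \<in> points G" "M \<in> lines G"
    using assms by (auto simp: elements_def)
  then obtain w where "nbw (adj G) w" "last w = x" "hd w = y" "length w \<in> {2, 4, 6}"
    using walk_exists by blast
  then show ?thesis using sg.nbw_rev by (intro exI[of _ "rev w"]) (auto simp: hd_rev last_rev)
next
  case False
  then obtain p M where "y = Inl p" "x = Inr M" "p \<in> points G" "M \<in> lines G"
    using assms by (auto simp: elements_def)
  then obtain w where "nbw (adj G) w" "last w = y" "hd w = x" "length w \<in> {2, 4, 6}"
    using walk_exists by blast
  then show ?thesis by (intro exI[of _ w]) auto
qed

text \<open>For elements of equal type, take the odd walk to a neighbour of \<open>y\<close> and
  then drop its last vertex or append \<open>y\<close>.\<close>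

lemma short_walk:
  assumes "x \<in> elements G" "y \<in> elements G"
  shows "\<exists>w. nbw (adj G) w \<and> w \<noteq> [] \<and> hd w = x \<and> last w = y \<and> length w \<le> 7"
proof (cases "isl x = isl y")
  case False
  then obtain w where "nbw (adj G) w" "hd w = x" "last w = y" "2 \<le> length w" "length w \<le> 6"
    using odd_walk assms by blast
  then show ?thesis by (intro exI[of _ w]) auto
next
  case True
  obtain z where z: "adj G y z" using deg[OF assms(2)] by blast
  then have "isl x \<noteq> isl z" "z \<in> elements G" using True adj_isl adj_elements[OF plg] by blast+
  then obtain w where w: "nbw (adj G) w" "hd w = x" "last w = z" "2 \<le> length w" "length w \<le> 6"
    using odd_walk[OF assms(1)] by blast
  obtain us where us: "w = us @ [z]" using w(3,4) by (cases w rule: rev_cases) auto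
  moreover from us have "us \<noteq> []" using w(4) by auto
  ultimately have us: "w = us @ [z]" "us \<noteq> []" by blast+
  show ?thesis
  proof (cases "last us = y")
    case True
    then show ?thesis using us w nbw_butlast[of "adj G" us "[z]"] by (intro exI[of _ us]) auto
  next
    case False
    have "nbw (adj G) (us @ [z, y])"
      using us w False z adj_sym by (intro nbw_snoc) auto
    then show ?thesis using us w by (intro exI[of _ "us @ [z, y]"]) auto
  qed
qed

lemma extend_walk:
  assumes "nbw (adj G) w" "w \<noteq> []" "last w \<in> elements G" "length w \<le> 7"
  shows "\<exists>u. nbw (adj G) (w @ u) \<and> length (w @ u) = 7"
  using assms
proof (induction "7 - length w" arbitrary: w)
  case 0
  then show ?case by (intro exI[of _ "[]"]) auto
next
  case (Suc k)
  obtain us x where us: "w = us @ [x]" using Suc.prems(2) by (cases w rule: rev_cases) auto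
  obtain z where z: "adj G x z" "z \<noteq> last us" using deg[of x] Suc.prems(3) us by auto
  have "nbw (adj G) (us @ [x, z])" using us Suc.prems(1) z by (intro nbw_snoc) auto
  moreover have "z \<in> elements G" using adj_elements[OF plg z(1)] by blast
  moreover have k: "k = 7 - length (w @ [z])" "length (w @ [z]) \<le> 7" using Suc.hyps(2) by simp_all
  ultimately obtain u where "nbw (adj G) ((w @ [z]) @ u)" "length ((w @ [z]) @ u) = 7"
    using Suc.hyps(1)[of "w @ [z]"] k us by auto
  then show ?case by (intro exI[of _ "z # u"]) auto
qed

text \<open>Leave \<open>a0\<close> by another edge, to \<open>b\<close>, and return by the odd walk
  from \<open>b\<close> to \<open>a6\<close>. Each way in which this could be too short or meet
  \<open>w\<close> next to an end gives two different walks with the same ends and at most 13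
  vertices in all.\<close>

lemma close_walk:
  assumes w: "nbw (adj G) w" "length w = 7"
  shows "\<exists>c. cycle (adj G) 12 c \<and> set w \<subseteq> range c"
proof -
  obtain a0 a1 a2 a3 a4 a5 a6 where a: "w = [a0, a1, a2, a3, a4, a5, a6]"
    using w(2) by (auto simp: length_Suc_conv eval_nat_numeral)
  have el: "a0 \<in> elements G" "a6 \<in> elements G"
    using w(1) a adj_elements[OF plg] by (auto simp: nbw_Cons)
  obtain b where b: "adj G a0 b" "b \<noteq> a1" using deg[OF el(1)] by blast
  have "isl a0 = isl a6"
    using successively_isl[of G a0 "tl w"] w(1) a by (auto simp: nbw_def)
  then have "isl b \<noteq> isl a6" "b \<in> elements G" using b adj_isl[of G a0 b] adj_elements[OF plg b(1)] by auto
  then obtain u where u: "nbw (adj G) u" "hd u = b" "last u = a6" "2 \<le> length u" "length u \<le> 6"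
    using odd_walk[OF _ el(2)] by blast
  obtain b1 us where us: "u = b # b1 # us" using u by (cases u; cases "tl u") auto
  have "b1 \<noteq> a0"
  proof
    assume "b1 = a0"
    then have "a0 # us = w" using u us w a
      by (intro nbw_unique') (auto dest: nbw_ConsD simp: nbw_Cons)
    then show False using u us w by auto
  qed
  then have n: "nbw (adj G) (a0 # u)" using u us b by (simp add: nbw_Cons)
  have "length u = 6"
  proof (rule ccontr)
    assume "length u \<noteq> 6"
    then have "a0 # u = w" using u us n w a by (intro nbw_unique') auto
    then show False using a us b by simp
  qed
  then obtain b2 b3 b4 where u': "u = [b, b1, b2, b3, b4, a6]"
    using us u(3) by (auto simp: length_Suc_conv eval_nat_numeral)
  have "a5 \<noteq> b4"
  proof
    assume "a5 = b4"
    then have "[a0, a1, a2, a3, a4, a5] = [a0, b, b1, b2, b3, b4]"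
      using nbw_butlast[of "adj G" "[a0, a1, a2, a3, a4, a5]" "[a6]"] w a
        nbw_butlast[of "adj G" "[a0, b, b1, b2, b3, b4]" "[a6]"] n u'
      by (intro nbw_unique') auto
    then show False using b by simp
  qed
  then have "nbw (adj G) (rev [a5, a4, a3, a2, a1, a0] @ a6 # [b4, b3, b2, b1, b])"
    using sg.nbw_rev[OF w(1)] sg.nbw_rev[OF n] a u'
    by (intro sg.nbw_glue) (auto simp: nbw_Cons)
  then have nl: "nbw (adj G) [a0, a1, a2, a3, a4, a5, a6, b4, b3, b2, b1, b]" by simp
  then have d: "distinct [a0, a1, a2, a3, a4, a5, a6, b4, b3, b2, b1, b]" (is "distinct ?l")
    by (rule girth) simp
  have "cycle (adj G) 12 (\<lambda>i. ?l ! (i mod 12))"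
  proof (rule cycleI)
    show "inj_on ((!) ?l) {..<12}" using d by (intro inj_on_nth) auto
    show "adj G (?l ! i) (?l ! Suc i)" if "Suc i < 12" for i using nbw_nth(1)[OF nl, of i] that by simp
    show "adj G (?l ! (12 - 1)) (?l ! 0)" using b adj_sym by simp
  qed simp
  moreover have "set w \<subseteq> range (\<lambda>i. ?l ! (i mod 12))"
  proof
    fix z assume "z \<in> set w"
    then have "z \<in> set ?l" using a by auto
    then obtain i where "i < length ?l" "z = ?l ! i" by (metis in_set_conv_nth)
    then show "z \<in> range (\<lambda>i. ?l ! (i mod 12))" by (intro range_eqI[of _ _ i]) simp
  qed
  ultimately show ?thesis by blast
qed

lemma weak_hexagon: "weak_generalized_polygon 6 G"
proof (rule weak_hexagonI[OF plg])
  show "girth12 (adj G)" by (rule girth12_axioms)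
  fix x y assume xy: "x \<in> elements G" "y \<in> elements G"
  then obtain w where w: "nbw (adj G) w" "w \<noteq> []" "hd w = x" "last w = y" "length w \<le> 7"
    using short_walk by blast
  then obtain u where u: "nbw (adj G) (w @ u)" "length (w @ u) = 7"
    using extend_walk xy by metis
  obtain c where "cycle (adj G) 12 c" "set (w @ u) \<subseteq> range c" using close_walk[OF u] by blast
  moreover have "x \<in> set (w @ u)" "y \<in> set (w @ u)" using w hd_in_set[of w] last_in_set[of w] by auto
  ultimately show "\<exists>c. cycle (adj G) 12 c \<and> x \<in> range c \<and> y \<in> range c" by blast
qed

end

section \<open>Geometries given by neighbour lists\<close>

definition nbrs :: "nat \<Rightarrow> (nat \<Rightarrow> nat list) \<Rightarrow> (nat \<Rightarrow> nat list) \<Rightarrow> nat + nat \<Rightarrow> (nat + nat) list" where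
  "nbrs n ls ps a = (case a of Inl x \<Rightarrow> if x < n then map Inr (ls x) else []
                             | Inr M \<Rightarrow> if M < n then map Inl (ps M) else [])"

definition list_geometry :: "nat \<Rightarrow> (nat \<Rightarrow> nat list) \<Rightarrow> (nat, nat) geometry" where
  "list_geometry n ls = \<lparr>points = {..<n}, lines = {..<n}, inc = (\<lambda>x M. x < n \<and> M \<in> set (ls x))\<rparr>"

text \<open>\<open>ps\<close> records the incidences again from the side of the lines, so that all
  neighbours are explicit lists and the hypotheses can be decided by evaluation.\<close>

lemma list_geometry_hexagon:
  assumes n: "0 < n" and k: "2 \<le> k"
    and ls: "\<And>x. x < n \<Longrightarrow> distinct (ls x) \<and> length (ls x) = k \<and> (\<forall>M\<in>set (ls x). M < n \<and> x \<in> set (ps M))"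
    and ps: "\<And>M. M < n \<Longrightarrow> distinct (ps M) \<and> length (ps M) = k \<and> (\<forall>x\<in>set (ps M). x < n \<and> M \<in> set (ls x))"
    and walks: "\<And>x. x < n \<Longrightarrow> distinct (map hd (odd_walks (nbrs n ls ps) (Inl x))) \<and>
      length (odd_walks (nbrs n ls ps) (Inl x)) = n"
  shows "weak_generalized_polygon 6 (list_geometry n ls)"
    and "has_order (list_geometry n ls) (k - 1) (k - 1)"
    and "finite_geometry (list_geometry n ls)"
proof -
  let ?G = "list_geometry n ls" and ?N = "nbrs n ls ps"
  have inc1: "inc ?G x M \<longleftrightarrow> x < n \<and> M \<in> set (ls x)" for x M
    by (simp add: list_geometry_def)
  have inc2: "inc ?G x M \<longleftrightarrow> M < n \<and> x \<in> set (ps M)" for x M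
    unfolding inc1 using ls ps by blast
  have pl: "points ?G = {..<n}" "lines ?G = {..<n}" by (simp_all add: list_geometry_def)
  show fin: "finite_geometry ?G" by (simp add: finite_geometry_def pl)
  have adjN: "adj ?G a b \<longleftrightarrow> b \<in> set (?N a)" for a b
  proof (cases a)
    case (Inl x)
    then show ?thesis by (cases b) (auto simp: nbrs_def inc1)
  next
    case (Inr M)
    then show ?thesis by (cases b) (auto simp: nbrs_def inc2)
  qed
  have plg: "point_line_geometry ?G"
    using n inc1 inc2 by (auto simp: point_line_geometry_def pl)
  have card_k: "card {M \<in> lines ?G. inc ?G x M} = k" "card {y \<in> points ?G. inc ?G y M} = k"
    if "x < n" "M < n" for x M
  proof -
    have "{M \<in> lines ?G. inc ?G x M} = set (ls x)" using ls[OF that(1)] that(1) by (auto simp: pl inc1)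
    then show "card {M \<in> lines ?G. inc ?G x M} = k" using ls[OF that(1)] distinct_card by fastforce
    have "{y \<in> points ?G. inc ?G y M} = set (ps M)" using ps[OF that(2)] that(2) by (auto simp: pl inc2)
    then show "card {y \<in> points ?G. inc ?G y M} = k" using ps[OF that(2)] distinct_card by fastforce
  qed
  then show ord: "has_order ?G (k - 1) (k - 1)" using n k by (auto simp: has_order_def pl)
  interpret moore_hexagon ?G ?N
  proof
    show "\<exists>z. adj ?G a z \<and> z \<noteq> b" if "a \<in> elements ?G" for a b
    proof (rule ccontr)
      assume "\<not> ?thesis"
      then have "{z. adj ?G a z} \<subseteq> {b}" by auto
      then have "card {z. adj ?G a z} \<le> card {b}" by (intro card_mono) auto
      then show False
        using has_order_card[OF plg ord] that k by (cases a) (auto simp: elements_def)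
    qed
  qed (use plg adjN walks fin in \<open>auto simp: pl finite_geometry_def\<close>)
  show "weak_generalized_polygon 6 ?G" by (rule weak_hexagon)
qed

lemma ext_map:
  assumes "inj \<phi>" "\<And>a. N (\<phi> a) = map \<phi> (N a)"
  shows "ext N (map \<phi> w) = map (map \<phi>) (ext N w)"
  by (cases "(N, w)" rule: ext.cases)
    (auto simp: assms(2) filter_map o_def inj_eq[OF assms(1)])

text \<open>An automorphism that also respects the order of the neighbour lists carries the list of
  walks to the list of walks, so a check at one vertex serves its whole orbit.\<close>

lemma walks_map:
  assumes "inj \<phi>" "\<And>a. N (\<phi> a) = map \<phi> (N a)"
  shows "walks N (\<phi> x) k = map (map \<phi>) (walks N x k)"
  by (induction k) (simp_all add: ext_map[of \<phi> N, OF assms] map_concat o_def)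

lemma walks_nonempty: "w \<in> set (walks N x k) \<Longrightarrow> w \<noteq> []"
proof (cases k)
  case (Suc m)
  assume "w \<in> set (walks N x k)"
  then obtain u where "w \<in> set (ext N u)" using Suc by auto
  then show ?thesis by (cases "(N, u)" rule: ext.cases) auto
qed auto

lemma odd_walks_map:
  assumes "inj \<phi>" "\<And>a. N (\<phi> a) = map \<phi> (N a)"
  shows "map hd (odd_walks N (\<phi> x)) = map \<phi> (map hd (odd_walks N x))"
    "length (odd_walks N (\<phi> x)) = length (odd_walks N x)"
proof -
  have e: "odd_walks N (\<phi> x) = map (map \<phi>) (odd_walks N x)"
    unfolding odd_walks_def walks_map[of \<phi> N, OF assms] map_append ..
  have "w \<noteq> []" if "w \<in> set (odd_walks N x)" for w
    using that unfolding odd_walks_def set_append Un_iff by (elim disjE) (rule walks_nonempty, assumption)+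
  then show "map hd (odd_walks N (\<phi> x)) = map \<phi> (map hd (odd_walks N x))"
    unfolding e map_map by (intro map_cong refl) (simp add: hd_map)
  show "length (odd_walks N (\<phi> x)) = length (odd_walks N x)" unfolding e by simp
qed

section \<open>The ordinary hexagon and the Tutte 12-cage\<close>

definition hexagon_lines :: "nat \<Rightarrow> nat list" where
  "hexagon_lines x = [x, (x + 5) mod 6]"

definition hexagon_points :: "nat \<Rightarrow> nat list" where
  "hexagon_points M = [M, (M + 1) mod 6]"

lemma hexagon_check:
  "\<forall>x\<in>set [0..<6]. distinct (hexagon_lines x) \<and> length (hexagon_lines x) = 2 \<and>
     (\<forall>M\<in>set (hexagon_lines x). M < 6 \<and> x \<in> set (hexagon_points M))"
  "\<forall>M\<in>set [0..<6]. distinct (hexagon_points M) \<and> length (hexagon_points M) = 2 \<and>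
     (\<forall>x\<in>set (hexagon_points M). x < 6 \<and> M \<in> set (hexagon_lines x))"
  "\<forall>x\<in>set [0..<6]. distinct (map hd (odd_walks (nbrs 6 hexagon_lines hexagon_points) (Inl x))) \<and>
     length (odd_walks (nbrs 6 hexagon_lines hexagon_points) (Inl x)) = 6"
  by code_simp+

lemma thin_hexagon: "thin_generalized_hexagon (list_geometry 6 hexagon_lines) 1"
proof -
  have m: "x \<in> set [0..<6]" if "x < 6" for x :: nat using that by simp
  note h = list_geometry_hexagon[of 6 2, OF _ _ bspec[OF hexagon_check(1) m]
      bspec[OF hexagon_check(2) m] bspec[OF hexagon_check(3) m]]
  have "weak_generalized_polygon 6 (list_geometry 6 hexagon_lines)"
    "has_order (list_geometry 6 hexagon_lines) (2 - 1) (2 - 1)"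
    "finite_geometry (list_geometry 6 hexagon_lines)"
    by (rule h; simp)+
  moreover from this have "\<not> thick (list_geometry 6 hexagon_lines)"
    using thick_order by (fastforce simp: weak_generalized_polygon_def)
  ultimately show ?thesis by (simp add: thin_generalized_hexagon_def)
qed

text \<open>A generalized hexagon of order (2, 2) whose incidence graph is the Tutte 12-cage: numbering along
  the Hamiltonian cycle of the cage, point \<open>x\<close> is on the lines \<open>x\<close>, \<open>x - 1\<close> and \<open>x + j\<close> modulo 63,
  where the chord length \<open>j\<close> depends on \<open>x\<close> modulo 9 (from the LCF notation of the cage).\<close>

definition cayley_lines :: "nat \<Rightarrow> nat list" where
  "cayley_lines x = [x, (x + 62) mod 63, (x + [8, 56, 45, 57, 36, 49, 28, 52, 29] ! (x mod 9)) mod 63]"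

text \<open>On the Hamiltonian cycle, point \<open>x\<close> is vertex \<open>2 * x\<close> and line
  \<open>M\<close> is vertex \<open>2 * M + 1\<close>. An LCF entry \<open>o\<close> at a line
  therefore adds \<open>(o + 1) div 2\<close> to the index, while at a point it adds
  \<open>(o - 1) div 2\<close>. Both lists come from the 18 entries of one LCF period.\<close>

definition cayley_points :: "nat \<Rightarrow> nat list" where
  "cayley_points M = [M, (M + 1) mod 63, (M + [14, 34, 18, 7, 27, 11, 6, 35, 55] ! (M mod 9)) mod 63]"

abbreviation cayley_nbrs :: "nat + nat \<Rightarrow> (nat + nat) list" where
  "cayley_nbrs \<equiv> nbrs 63 cayley_lines cayley_points"

text \<open>The automorphism \<open>x \<mapsto> x + 9\<close> leaves only nine points for which walks must be counted.\<close>

definition shift9 :: "nat \<Rightarrow> nat" where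
  "shift9 x = (if x < 54 then x + 9 else if x < 63 then x - 54 else x)"

lemma cayley_check:
  "\<forall>x\<in>set [0..<63]. distinct (cayley_lines x) \<and> length (cayley_lines x) = 3 \<and>
     (\<forall>M\<in>set (cayley_lines x). M < 63 \<and> x \<in> set (cayley_points M))"
  "\<forall>M\<in>set [0..<63]. distinct (cayley_points M) \<and> length (cayley_points M) = 3 \<and>
     (\<forall>x\<in>set (cayley_points M). x < 63 \<and> M \<in> set (cayley_lines x))"
  "\<forall>x\<in>set [0..<63]. cayley_lines (shift9 x) = map shift9 (cayley_lines x)"
  "\<forall>M\<in>set [0..<63]. cayley_points (shift9 M) = map shift9 (cayley_points M)"
  by code_simp+

text \<open>With degree 3 there are 3, 12 and 48 walks of 1, 3 and 5 edges without backtracking;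
  their sum 63 is the number of lines.\<close>

lemma cayley_walks_check:
  "\<forall>x\<in>set [0..<9]. distinct (map hd (odd_walks cayley_nbrs (Inl x))) \<and>
     length (odd_walks cayley_nbrs (Inl x)) = 63"
  by code_simp

lemma cayley_nbrs_shift:
  "cayley_nbrs (map_sum shift9 shift9 a) = map (map_sum shift9 shift9) (cayley_nbrs a)"
proof -
  have s: "shift9 x < 63 \<longleftrightarrow> x < 63" for x by (auto simp: shift9_def)
  have m: "x \<in> set [0..<63]" if "x < 63" for x :: nat using that by simp
  have "cayley_lines (shift9 x) = map shift9 (cayley_lines x)"
    "cayley_points (shift9 x) = map shift9 (cayley_points x)" if "x < 63" for x
    using bspec[OF cayley_check(3) m[OF that]] bspec[OF cayley_check(4) m[OF that]] .
  then show ?thesis by (cases a) (auto simp: nbrs_def s)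
qed

text \<open>Numbers from 63 on are fixed by \<open>shift9\<close>, which makes it injective on the
  whole type, as the transport of walks requires.\<close>

lemma inj_shift: "inj (map_sum shift9 shift9)"
proof -
  have "inj shift9" by (rule injI) (auto simp: shift9_def split: if_splits)
  then show ?thesis by (intro injI; rename_tac x y; case_tac x; case_tac y) (auto dest: injD)
qed

lemma cayley_walks:
  "x < 63 \<Longrightarrow> distinct (map hd (odd_walks cayley_nbrs (Inl x))) \<and>
     length (odd_walks cayley_nbrs (Inl x)) = 63"
proof (induction x rule: less_induct)
  case (less x)
  show ?case
  proof (cases "x < 9")
    case True
    then have "x \<in> set [0..<9]" by simp
    then show ?thesis by (rule bspec[OF cayley_walks_check])
  next
    case False
    then have x: "Inl x = map_sum shift9 shift9 (Inl (x - 9))" using less.prems by (simp add: shift9_def)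
    have "distinct (map hd (odd_walks cayley_nbrs (Inl (x - 9)))) \<and>
        length (odd_walks cayley_nbrs (Inl (x - 9))) = 63"
      using less False by simp
    then show ?thesis
      unfolding x odd_walks_map[of _ cayley_nbrs, OF inj_shift cayley_nbrs_shift]
      distinct_map[of "map_sum shift9 shift9"]
      using inj_on_subset[OF inj_shift subset_UNIV] by blast
  qed
qed

lemma order_2_thick:
  assumes "has_order G 2 2" shows "thick G"
proof -
  have "card {M \<in> lines G. inc G x M} = 3" if "x \<in> points G" for x
    using assms that by (simp add: has_order_def)
  moreover have "card {x \<in> points G. inc G x M} = 3" if "M \<in> lines G" for M
    using assms that by (simp add: has_order_def)
  ultimately show ?thesis unfolding thick_def by blast
qed

lemma cayley_hexagon:
  "finite_geometry (list_geometry 63 cayley_lines)"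
  "thick_generalized_hexagon (list_geometry 63 cayley_lines) 2 2"
proof -
  have m: "x \<in> set [0..<63]" if "x < 63" for x :: nat using that by simp
  note h = list_geometry_hexagon[of 63 3, OF _ _ bspec[OF cayley_check(1) m]
      bspec[OF cayley_check(2) m] cayley_walks]
  have S: "weak_generalized_polygon 6 (list_geometry 63 cayley_lines)"
    "has_order (list_geometry 63 cayley_lines) (3 - 1) (3 - 1)"
    "finite_geometry (list_geometry 63 cayley_lines)"
    by (rule h; simp)+
  have "thick (list_geometry 63 cayley_lines)"
    using S(2) by (intro order_2_thick) simp
  then show "finite_geometry (list_geometry 63 cayley_lines)"
    "thick_generalized_hexagon (list_geometry 63 cayley_lines) 2 2"
    using S by (simp_all add: thick_generalized_hexagon_def)
qed

theorem theorem5p1: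
  shows
    "(\<forall>(S :: ('p, 'l) geometry) s t (G :: ('q, 'm) geometry) s' \<Phi>.
        finite_geometry S \<and> thick_generalized_hexagon S s t \<and>
        thin_generalized_hexagon G s' \<and> epimorphism S G \<Phi> \<longrightarrow>
          s' = 1 \<and> (class_a S s G \<Phi> \<or> class_b S t G \<Phi>)) \<and>
     (\<forall>(S :: ('p, 'l) geometry) s t (G :: ('q, 'm) geometry).
        finite_geometry S \<and> thick_generalized_hexagon S s t \<and>
        thin_generalized_hexagon G 1 \<longrightarrow>
          (\<exists>\<Phi>. epimorphism S G \<Phi> \<and> class_a S s G \<Phi>) \<and>
          (\<exists>\<Phi>. epimorphism S G \<Phi> \<and> class_b S t G \<Phi>)) \<and>
     (\<exists>(S :: (nat, nat) geometry) s t (G :: (nat, nat) geometry) s' \<Phi>.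
        finite_geometry S \<and> thick_generalized_hexagon S s t \<and>
        thin_generalized_hexagon G s' \<and> epimorphism S G \<Phi> \<and> class_a S s G \<Phi>) \<and>
     (\<exists>(S :: (nat, nat) geometry) s t (G :: (nat, nat) geometry) s' \<Phi>.
        finite_geometry S \<and> thick_generalized_hexagon S s t \<and>
        thin_generalized_hexagon G s' \<and> epimorphism S G \<Phi> \<and> class_b S t G \<Phi>)"
proof (intro conjI allI impI, goal_cases)
  case (1 S s t G s' \<Phi>)
  then show ?case using epimorphism_classification by blast
next
  case (2 S s t G s' \<Phi>)
  then show ?case using epimorphism_classification by blast
next
  case (3 S s t G)
  then show ?case using exists_class_a by blast
next
  case (4 S s t G)
  then show ?case using exists_class_b by blast
next
  \<comment> \<open>The general construction of both classes starts from a given thick hexagon; only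
    a concrete one shows that the classes really occur.\<close>
  case 5
  show ?case
    using cayley_hexagon thin_hexagon exists_class_a[OF cayley_hexagon thin_hexagon] by blast
next
  case 6
  show ?case
    using cayley_hexagon thin_hexagon exists_class_b[OF cayley_hexagon thin_hexagon] by blast
qed

end
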